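(* Let $(u_n)_{n\ge1}$ be a normalized $1$-unconditional Schauder basis of a Banach space $U$ over $\mathbb K$, and let each $B_n$ $(n\ge1)$ be a nonzero unital Banach algebra with $\|1_{B_n}\|=1$. Let $A=(\bigoplus_nB_n)_U\oplus\mathbb KI$ with $$(b+\lambda I)(c+\mu I)=bc+\lambda c+\mu b+\lambda\mu I,\qquad\|b+\lambda I\|=\|b\|_U+|\lambda|,$$ where $(\bigoplus_nB_n)_U$ consists of the sequences $b=(b_n)$, $b_n\in B_n$, for which $\sum_n\|b_n\|u_n$ converges in $U$, with $\|b\|_U=\bigl\|\sum_n\|b_n\|u_n\bigr\|_U$ and coordinatewise multiplication. Then $A$ is isometrically isomorphic, as a unital Banach algebra, to the bounded inverse limit of an admissible system if and only if $(u_n)$ is boundedly complete and each $B_n$ is isometrically isomorphic, as a unital Banach algebra, to the bounded inverse limit of an admissible system.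
   Context: $\mathbb K=\mathbb R$ or $\mathbb C$. An admissible system is a countable inverse system $(A_r,\pi_r^s)_{r\le s}$, $r\in\mathbb N=\{0,1,\dots\}$, of finite-dimensional unital Banach algebras with algebra homomorphisms $\pi_r^s:A_s\to A_r$ $(r\le s)$ such that $\|1_{A_r}\|=1$, $\pi_r^s(1_{A_s})=1_{A_r}$, $\pi_r^s\pi_s^t=\pi_r^t$, and $\|x_r\|=\inf\{\|x_s\|:\pi_r^sx_s=x_r\}$ for every $x_r\in A_r$. Its bounded inverse limit is the algebra of compatible sequences $(a_r)_r$ ($\pi_r^sa_s=a_r$ for $r\le s$) with $\sup_r\|a_r\|<\infty$, coordinatewise multiplication and norm $\sup_r\|a_r\|$. The basis is normalized if $\|u_n\|=1$; $1$-unconditional if $\|\sum a_nu_n\|\le\|\sum b_nu_n\|$ for finitely supported scalars with $|a_n|\le|b_n|$; boundedly complete if $\sup_N\|\sum_{n\le N}a_nu_n\|<\infty$ implies that $\sum a_nu_n$ converges. *)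

theory Defs
  imports "HOL-Analysis.Analysis" "HOL-Algebra.QuotRing" "HOL-Algebra.Module"
begin

section \<open>Scalars\<close>

text \<open>
  The types whose normed field structure is, up to an isometric isomorphism, that of the real or
  of the complex numbers.
\<close>

class real_or_complex = real_normed_field +
  assumes ex_real_or_complex_iso:
    "\<exists>\<phi> :: 'a \<Rightarrow> complex.
       (\<forall>x y. \<phi> (x + y) = \<phi> x + \<phi> y) \<and> (\<forall>x y. \<phi> (x * y) = \<phi> x * \<phi> y) \<and>
       (\<forall>r x. \<phi> (r *\<^sub>R x) = r *\<^sub>R \<phi> x) \<and> (\<forall>x. norm (\<phi> x) = norm x) \<and>
       (range \<phi> = \<real> \<or> range \<phi> = UNIV)"

instance real :: real_or_complex
proof
  have "range complex_of_real = \<real>" unfolding Reals_def ..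
  then show "\<exists>\<phi> :: real \<Rightarrow> complex.
       (\<forall>x y. \<phi> (x + y) = \<phi> x + \<phi> y) \<and> (\<forall>x y. \<phi> (x * y) = \<phi> x * \<phi> y) \<and>
       (\<forall>r x. \<phi> (r *\<^sub>R x) = r *\<^sub>R \<phi> x) \<and> (\<forall>x. norm (\<phi> x) = norm x) \<and>
       (range \<phi> = \<real> \<or> range \<phi> = UNIV)"
    by (intro exI[of _ complex_of_real]) (simp add: scaleR_conv_of_real)
qed

instance complex :: real_or_complex
proof
  show "\<exists>\<phi> :: complex \<Rightarrow> complex.
       (\<forall>x y. \<phi> (x + y) = \<phi> x + \<phi> y) \<and> (\<forall>x y. \<phi> (x * y) = \<phi> x * \<phi> y) \<and>
       (\<forall>r x. \<phi> (r *\<^sub>R x) = r *\<^sub>R \<phi> x) \<and> (\<forall>x. norm (\<phi> x) = norm x) \<and>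
       (range \<phi> = \<real> \<or> range \<phi> = UNIV)"
    by (intro exI[of _ "\<lambda>x. x"]) simp
qed

definition scalar_ring :: "'k::real_or_complex ring" where
  "scalar_ring = \<lparr>carrier = UNIV, monoid.mult = (*), one = 1, zero = 0, add = (+)\<rparr>"

lemma cring_scalar_ring: "cring (scalar_ring :: 'k::real_or_complex ring)"
proof (rule cringI)
  have "\<exists>y. y + x = 0" for x :: 'k
    by (rule exI[of _ "- x"]) simp
  then show "abelian_group (scalar_ring :: 'k ring)"
    by (intro abelian_groupI) (simp_all add: scalar_ring_def add_ac)
  show "comm_monoid (scalar_ring :: 'k ring)"
    by (rule comm_monoidI) (auto simp: scalar_ring_def)
qed (simp add: scalar_ring_def distrib_right)


section \<open>Unital Banach algebras with explicit carriers\<close>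

record ('k, 'a) normed_algebra = "('k, 'a) module" +
  nrm :: "'a \<Rightarrow> real"

text \<open>The norm of the unit is not required to be 1 here, and the zero algebra is allowed.\<close>

locale unital_banach_algebra = ring A + scalars: Module.module scalar_ring A
  for A :: "('k::real_or_complex, 'a, 'm) normed_algebra_scheme" (structure) +
  assumes smult_mult_left:
      "\<lbrakk>x \<in> carrier A; y \<in> carrier A\<rbrakk> \<Longrightarrow> (c \<odot> x) \<otimes> y = c \<odot> (x \<otimes> y)"
    and smult_mult_right:
      "\<lbrakk>x \<in> carrier A; y \<in> carrier A\<rbrakk> \<Longrightarrow> x \<otimes> (c \<odot> y) = c \<odot> (x \<otimes> y)"
    and nrm_nonneg: "x \<in> carrier A \<Longrightarrow> 0 \<le> nrm A x"
    and nrm_eq_0_iff: "x \<in> carrier A \<Longrightarrow> nrm A x = 0 \<longleftrightarrow> x = \<zero>"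
    and nrm_triangle:
      "\<lbrakk>x \<in> carrier A; y \<in> carrier A\<rbrakk> \<Longrightarrow> nrm A (x \<oplus> y) \<le> nrm A x + nrm A y"
    and nrm_smult: "x \<in> carrier A \<Longrightarrow> nrm A (c \<odot> x) = norm c * nrm A x"
    and nrm_mult_le:
      "\<lbrakk>x \<in> carrier A; y \<in> carrier A\<rbrakk> \<Longrightarrow> nrm A (x \<otimes> y) \<le> nrm A x * nrm A y"
    and nrm_complete:
      "\<lbrakk>\<And>n. X n \<in> carrier A;
        \<forall>e>0. \<exists>M. \<forall>m\<ge>M. \<forall>n\<ge>M. nrm A (X m \<ominus> X n) < e\<rbrakk>
       \<Longrightarrow> \<exists>x\<in>carrier A. (\<lambda>n::nat. nrm A (X n \<ominus> x)) \<longlonglongrightarrow> 0"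

definition finite_dimensional ::
  "('k::real_or_complex, 'a, 'm) normed_algebra_scheme \<Rightarrow> bool" where
  "finite_dimensional A \<longleftrightarrow>
     (\<exists>S. finite S \<and> S \<subseteq> carrier A \<and>
        (\<forall>x\<in>carrier A. \<exists>c. x = (\<Oplus>\<^bsub>A\<^esub>s\<in>S. c s \<odot>\<^bsub>A\<^esub> s)))"

text \<open>Membership in \<^const>\<open>ring_hom\<close> includes preservation of the unit.\<close>

definition unital_algebra_hom ::
  "('k::real_or_complex, 'a, 'm) normed_algebra_scheme \<Rightarrow>
   ('k, 'b, 'n) normed_algebra_scheme \<Rightarrow> ('a \<Rightarrow> 'b) set" where
  "unital_algebra_hom A B =
     {h \<in> ring_hom A B. \<forall>c. \<forall>x\<in>carrier A. h (c \<odot>\<^bsub>A\<^esub> x) = c \<odot>\<^bsub>B\<^esub> h x}"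

definition isometrically_isomorphic ::
  "('k::real_or_complex, 'a, 'm) normed_algebra_scheme \<Rightarrow>
   ('k, 'b, 'n) normed_algebra_scheme \<Rightarrow> bool" where
  "isometrically_isomorphic A B \<longleftrightarrow>
     (\<exists>h \<in> unital_algebra_hom A B.
        bij_betw h (carrier A) (carrier B) \<and> (\<forall>x\<in>carrier A. nrm B (h x) = nrm A x))"


section \<open>Admissible systems and bounded inverse limits\<close>

text \<open>
  In \<open>admissible_system S p\<close>, the algebra \<open>S r\<close> is $A_r$ and \<open>p r s\<close>, for \<open>r \<le> s\<close>, is the
  bonding map $\pi_r^s \colon A_s \to A_r$. Since the infimum of the empty set is $+\infty$ in the
  quotient norm condition, that condition contains the surjectivity of the bonding maps; on
  \<^typ>\<open>real\<close> this has to be said separately.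
\<close>

definition admissible_system ::
  "(nat \<Rightarrow> ('k::real_or_complex, 'a) normed_algebra) \<Rightarrow> (nat \<Rightarrow> nat \<Rightarrow> 'a \<Rightarrow> 'a) \<Rightarrow> bool" where
  "admissible_system S p \<longleftrightarrow>
     (\<forall>r. unital_banach_algebra (S r) \<and> finite_dimensional (S r) \<and> nrm (S r) \<one>\<^bsub>S r\<^esub> = 1) \<and>
     (\<forall>r s. r \<le> s \<longrightarrow> p r s \<in> unital_algebra_hom (S s) (S r)) \<and>
     (\<forall>r. \<forall>x\<in>carrier (S r). p r r x = x) \<and>
     (\<forall>r s t. r \<le> s \<and> s \<le> t \<longrightarrow> (\<forall>x\<in>carrier (S t). p r s (p s t x) = p r t x)) \<and>
     (\<forall>r s. r \<le> s \<longrightarrow> (\<forall>x\<in>carrier (S r).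
        (\<exists>y\<in>carrier (S s). p r s y = x) \<and>
        nrm (S r) x = Inf {nrm (S s) y | y. y \<in> carrier (S s) \<and> p r s y = x}))"

definition bounded_inverse_limit ::
  "(nat \<Rightarrow> ('k::real_or_complex, 'a) normed_algebra) \<Rightarrow> (nat \<Rightarrow> nat \<Rightarrow> 'a \<Rightarrow> 'a) \<Rightarrow>
   ('k, nat \<Rightarrow> 'a) normed_algebra" where
  "bounded_inverse_limit S p =
     \<lparr>carrier = {a. (\<forall>r. a r \<in> carrier (S r)) \<and> (\<forall>r s. r \<le> s \<longrightarrow> p r s (a s) = a r) \<and>
                    bdd_above (range (\<lambda>r. nrm (S r) (a r)))},
      monoid.mult = (\<lambda>a b r. a r \<otimes>\<^bsub>S r\<^esub> b r),
      one = (\<lambda>r. \<one>\<^bsub>S r\<^esub>),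
      zero = (\<lambda>r. \<zero>\<^bsub>S r\<^esub>),
      add = (\<lambda>a b r. a r \<oplus>\<^bsub>S r\<^esub> b r),
      smult = (\<lambda>c a r. c \<odot>\<^bsub>S r\<^esub> a r),
      nrm = (\<lambda>a. SUP r. nrm (S r) (a r))\<rparr>"

text \<open>
  A definition cannot quantify over types, so the element type of the finite-dimensional algebras
  is fixed to \<open>nat \<Rightarrow> 'k\<close>. This loses no generality: a finite-dimensional algebra over \<open>'k\<close>,
  of whatever element type, can be transported along coordinates to a carrier in \<open>nat \<Rightarrow> 'k\<close>.
  Lemma \<open>is_bounded_inverse_limitI\<close> below proves this for whole systems.
\<close>

definition is_bounded_inverse_limit ::
  "('k::real_or_complex, 'a, 'm) normed_algebra_scheme \<Rightarrow> bool" where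
  "is_bounded_inverse_limit A \<longleftrightarrow>
     (\<exists>(S :: nat \<Rightarrow> ('k, nat \<Rightarrow> 'k) normed_algebra) p.
        admissible_system S p \<and> isometrically_isomorphic A (bounded_inverse_limit S p))"

subsection \<open>Independence of the element type\<close>

definition transport ::
  "('a \<Rightarrow> 'b) \<Rightarrow> ('k::real_or_complex, 'a) normed_algebra \<Rightarrow> ('k, 'b) normed_algebra" where
  "transport f A = (let g = inv_into (carrier A) f in
     \<lparr>carrier = f ` carrier A,
      monoid.mult = (\<lambda>x y. f (g x \<otimes>\<^bsub>A\<^esub> g y)),
      one = f \<one>\<^bsub>A\<^esub>,
      zero = f \<zero>\<^bsub>A\<^esub>,
      add = (\<lambda>x y. f (g x \<oplus>\<^bsub>A\<^esub> g y)),
      smult = (\<lambda>c x. f (c \<odot>\<^bsub>A\<^esub> g x)),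
      nrm = (\<lambda>x. nrm A (g x))\<rparr>)"

lemma transport_simps:
  assumes "inj_on f (carrier A)"
  shows "carrier (transport f A) = f ` carrier A"
    and "\<one>\<^bsub>transport f A\<^esub> = f \<one>\<^bsub>A\<^esub>"
    and "\<zero>\<^bsub>transport f A\<^esub> = f \<zero>\<^bsub>A\<^esub>"
    and "\<lbrakk>x \<in> carrier A; y \<in> carrier A\<rbrakk> \<Longrightarrow> f x \<otimes>\<^bsub>transport f A\<^esub> f y = f (x \<otimes>\<^bsub>A\<^esub> y)"
    and "\<lbrakk>x \<in> carrier A; y \<in> carrier A\<rbrakk> \<Longrightarrow> f x \<oplus>\<^bsub>transport f A\<^esub> f y = f (x \<oplus>\<^bsub>A\<^esub> y)"
    and "x \<in> carrier A \<Longrightarrow> c \<odot>\<^bsub>transport f A\<^esub> f x = f (c \<odot>\<^bsub>A\<^esub> x)"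
    and "x \<in> carrier A \<Longrightarrow> nrm (transport f A) (f x) = nrm A x"
  using assms by (simp_all add: transport_def Let_def)

lemma (in unital_banach_algebra) smult_carrier:
  "x \<in> carrier A \<Longrightarrow> c \<odot> x \<in> carrier A"
  using scalars.smult_closed[of c x] by (simp add: scalar_ring_def)

lemma (in unital_banach_algebra) smult_laws:
  "x \<in> carrier A \<Longrightarrow> (c + d) \<odot> x = c \<odot> x \<oplus> d \<odot> x"
  "x \<in> carrier A \<Longrightarrow> y \<in> carrier A \<Longrightarrow> c \<odot> (x \<oplus> y) = c \<odot> x \<oplus> c \<odot> y"
  "x \<in> carrier A \<Longrightarrow> (c * d) \<odot> x = c \<odot> (d \<odot> x)"
  "x \<in> carrier A \<Longrightarrow> 1 \<odot> x = x"
  using scalars.smult_l_distr[of c d x] scalars.smult_r_distr[of c x y]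
    scalars.smult_assoc1[of c d x] scalars.smult_one[of x]
  by (simp_all add: scalar_ring_def)

lemma unital_banach_algebra_transport:
  fixes A :: "('k::real_or_complex, 'a) normed_algebra"
  assumes A: "unital_banach_algebra A" and inj: "inj_on f (carrier A)"
  shows "unital_banach_algebra (transport f A)"
    and "x \<in> carrier A \<Longrightarrow> y \<in> carrier A \<Longrightarrow>
           f x \<ominus>\<^bsub>transport f A\<^esub> f y = f (x \<ominus>\<^bsub>A\<^esub> y)"
proof -
  interpret unital_banach_algebra A by (rule A)
  note [simp] = transport_simps[OF inj] smult_carrier
  have ab: "abelian_group (transport f A)"
  proof (rule abelian_groupI)
    fix x assume "x \<in> carrier (transport f A)"
    then obtain x' where x': "x' \<in> carrier A" "x = f x'" by auto
    then show "\<exists>y\<in>carrier (transport f A). y \<oplus>\<^bsub>transport f A\<^esub> x = \<zero>\<^bsub>transport f A\<^esub>"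
      by (intro bexI[of _ "f (\<ominus>\<^bsub>A\<^esub> x')"]) (auto simp: l_neg)
  qed (auto simp: a_ac)
  have mon: "monoid (transport f A)"
    by (rule monoidI) (auto simp: m_assoc)
  have ring: "ring (transport f A)"
    by (rule ringI[OF ab mon]) (auto simp: l_distr r_distr)
  interpret h: ring_hom_ring A "transport f A" f
    by (rule ring_hom_ringI[OF ring_axioms ring]) auto
  have f_minus: "f (\<ominus>\<^bsub>A\<^esub> y) = \<ominus>\<^bsub>transport f A\<^esub> f y" if "y \<in> carrier A" for y
    using that by (rule h.hom_a_inv)
  note [simp del] = h.hom_a_inv h.hom_add h.hom_mult h.hom_zero h.hom_one
  show diff: "f x \<ominus>\<^bsub>transport f A\<^esub> f y = f (x \<ominus>\<^bsub>A\<^esub> y)"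
    if "x \<in> carrier A" "y \<in> carrier A" for x y
    using that by (simp add: a_minus_def flip: f_minus)
  have module: "Module.module scalar_ring (transport f A)"
    by (rule moduleI[OF cring_scalar_ring ab]) (auto simp: scalar_ring_def smult_laws)
  show "unital_banach_algebra (transport f A)"
  proof (intro unital_banach_algebra.intro ring module unital_banach_algebra_axioms.intro)
    fix X :: "nat \<Rightarrow> 'b"
    assume X: "\<And>n. X n \<in> carrier (transport f A)"
      and C: "\<forall>e>0. \<exists>M. \<forall>m\<ge>M. \<forall>n\<ge>M.
                nrm (transport f A) (X m \<ominus>\<^bsub>transport f A\<^esub> X n) < e"
    have "\<forall>n. \<exists>y. y \<in> carrier A \<and> X n = f y" using X by auto
    then obtain Y where Y: "\<And>n. Y n \<in> carrier A" "\<And>n. X n = f (Y n)" by metis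
    have "\<exists>x\<in>carrier A. (\<lambda>n::nat. nrm A (Y n \<ominus>\<^bsub>A\<^esub> x)) \<longlonglongrightarrow> 0"
      by (rule nrm_complete[OF Y(1)]) (use C in \<open>simp add: Y diff\<close>)
    then show "\<exists>x\<in>carrier (transport f A).
        (\<lambda>n. nrm (transport f A) (X n \<ominus>\<^bsub>transport f A\<^esub> x)) \<longlonglongrightarrow> 0"
      by (auto simp: Y diff)
  next
    fix x assume "x \<in> carrier (transport f A)"
    then show "(nrm (transport f A) x = 0) = (x = \<zero>\<^bsub>transport f A\<^esub>)"
      using inj by (auto simp: nrm_eq_0_iff inj_on_eq_iff)
  qed (auto simp: smult_mult_left smult_mult_right nrm_nonneg nrm_triangle nrm_smult nrm_mult_le)
qed

lemma finite_dimensional_transport: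
  fixes A :: "('k::real_or_complex, 'a) normed_algebra"
  assumes A: "unital_banach_algebra A" and inj: "inj_on f (carrier A)"
    and fin: "finite_dimensional A"
  shows "finite_dimensional (transport f A)"
proof -
  interpret A: unital_banach_algebra A by (rule A)
  interpret T: unital_banach_algebra "transport f A"
    by (rule unital_banach_algebra_transport[OF A inj])
  note [simp] = transport_simps[OF inj] A.smult_carrier
  from fin obtain S where S: "finite S" "S \<subseteq> carrier A"
    "\<forall>x\<in>carrier A. \<exists>c. x = (\<Oplus>\<^bsub>A\<^esub>s\<in>S. c s \<odot>\<^bsub>A\<^esub> s)"
    unfolding finite_dimensional_def by blast
  have sum: "F \<subseteq> carrier A \<Longrightarrow>
      f (\<Oplus>\<^bsub>A\<^esub>s\<in>F. c s \<odot>\<^bsub>A\<^esub> s) =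
      (\<Oplus>\<^bsub>transport f A\<^esub>t\<in>f ` F. c (inv_into (carrier A) f t) \<odot>\<^bsub>transport f A\<^esub> t)"
    if "finite F" for F c
    using that
  proof (induction F rule: finite_induct)
    case empty
    then show ?case by simp
  next
    case (insert s F)
    have 1: "f s \<notin> f ` F" using insert inj by (auto simp: inj_on_def)
    have 2: "(\<Oplus>\<^bsub>A\<^esub>s\<in>F. c s \<odot>\<^bsub>A\<^esub> s) \<in> carrier A"
      using insert by (intro A.finsum_closed) auto
    have "(\<lambda>t. c (inv_into (carrier A) f t) \<odot>\<^bsub>transport f A\<^esub> t) \<in> f ` F \<rightarrow> carrier (transport f A)"
      using insert inj by auto
    then have "(\<Oplus>\<^bsub>transport f A\<^esub>t\<in>f ` insert s F. c (inv_into (carrier A) f t) \<odot>\<^bsub>transport f A\<^esub> t)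
       = f (c s \<odot>\<^bsub>A\<^esub> s) \<oplus>\<^bsub>transport f A\<^esub> f (\<Oplus>\<^bsub>A\<^esub>s\<in>F. c s \<odot>\<^bsub>A\<^esub> s)"
      using insert 1 inj by (simp add: T.finsum_insert del: transport_simps(1))
    also have "\<dots> = f (c s \<odot>\<^bsub>A\<^esub> s \<oplus>\<^bsub>A\<^esub> (\<Oplus>\<^bsub>A\<^esub>s\<in>F. c s \<odot>\<^bsub>A\<^esub> s))"
      using 2 insert.prems by (intro transport_simps[OF inj]) auto
    also have "\<dots> = f (\<Oplus>\<^bsub>A\<^esub>s\<in>insert s F. c s \<odot>\<^bsub>A\<^esub> s)"
      using insert by (subst A.finsum_insert) auto
    finally show ?case by simp
  qed
  show ?thesis
    unfolding finite_dimensional_def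
  proof (intro exI[of _ "f ` S"] conjI ballI)
    fix y assume "y \<in> carrier (transport f A)"
    then obtain x where x: "x \<in> carrier A" "y = f x" by auto
    then obtain c where "x = (\<Oplus>\<^bsub>A\<^esub>s\<in>S. c s \<odot>\<^bsub>A\<^esub> s)" using S(3) by blast
    then show "\<exists>c. y = (\<Oplus>\<^bsub>transport f A\<^esub>s\<in>f ` S. c s \<odot>\<^bsub>transport f A\<^esub> s)"
      using sum[OF S(1,2), of c] x by auto
  qed (use S in auto)
qed

lemma finite_dimensional_ex_inj:
  fixes A :: "('k::real_or_complex, 'a) normed_algebra"
  assumes "unital_banach_algebra A" "finite_dimensional A"
  shows "\<exists>f :: 'a \<Rightarrow> nat \<Rightarrow> 'k. inj_on f (carrier A)"
proof -
  interpret unital_banach_algebra A by fact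
  from assms(2) obtain S where S: "finite S" "S \<subseteq> carrier A"
    "\<forall>x\<in>carrier A. \<exists>c. x = (\<Oplus>\<^bsub>A\<^esub>s\<in>S. c s \<odot>\<^bsub>A\<^esub> s)"
    unfolding finite_dimensional_def by blast
  then obtain c where c: "\<And>x. x \<in> carrier A \<Longrightarrow> x = (\<Oplus>\<^bsub>A\<^esub>s\<in>S. c x s \<odot>\<^bsub>A\<^esub> s)"
    by metis
  obtain e :: "'a \<Rightarrow> nat" where e: "inj_on e S"
    using finite_imp_inj_to_nat_seg[OF S(1)] by blast
  define f where "f = (\<lambda>x i. c x (inv_into S e i))"
  have "inj_on f (carrier A)"
  proof (rule inj_onI)
    fix x y assume xy: "x \<in> carrier A" "y \<in> carrier A" "f x = f y"
    have "c x s = c y s" if "s \<in> S" for s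
      using fun_cong[OF xy(3), of "e s"] e that by (simp add: f_def)
    then have "(\<Oplus>\<^bsub>A\<^esub>s\<in>S. c x s \<odot>\<^bsub>A\<^esub> s) = (\<Oplus>\<^bsub>A\<^esub>s\<in>S. c y s \<odot>\<^bsub>A\<^esub> s)"
      using S(2) by (intro finsum_cong') (auto intro!: smult_carrier)
    then show "x = y" using c xy by metis
  qed
  then show ?thesis by blast
qed

lemma is_bounded_inverse_limitI:
  fixes A :: "('k::real_or_complex, 'a, 'm) normed_algebra_scheme"
    and S :: "nat \<Rightarrow> ('k, 'c) normed_algebra"
  assumes adm: "admissible_system S p"
    and iso: "isometrically_isomorphic A (bounded_inverse_limit S p)"
  shows "is_bounded_inverse_limit A"
proof -
  have S: "unital_banach_algebra (S r)" "finite_dimensional (S r)" "nrm (S r) \<one>\<^bsub>S r\<^esub> = 1" for r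
    using adm by (auto simp: admissible_system_def)
  have hom: "p r s \<in> unital_algebra_hom (S s) (S r)" if "r \<le> s" for r s
    using adm that by (auto simp: admissible_system_def)
  have "\<forall>r. \<exists>f :: 'c \<Rightarrow> nat \<Rightarrow> 'k. inj_on f (carrier (S r))"
    using finite_dimensional_ex_inj S by blast
  then obtain f :: "nat \<Rightarrow> 'c \<Rightarrow> nat \<Rightarrow> 'k" where f: "\<And>r. inj_on (f r) (carrier (S r))"
    by metis
  define g where "g = (\<lambda>r. inv_into (carrier (S r)) (f r))"
  define T where "T = (\<lambda>r. transport (f r) (S r))"
  define q where "q = (\<lambda>r s y. f r (p r s (g s y)))"
  have g[simp]: "g r (f r x) = x" if "x \<in> carrier (S r)" for r x
    using f that by (simp add: g_def)
  have f_eq[simp]: "f r x = f r y \<longleftrightarrow> x = y" if "x \<in> carrier (S r)" "y \<in> carrier (S r)" for r x y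
    by (rule inj_on_eq_iff[OF f that])
  have T': "carrier (T r) = f r ` carrier (S r)" "\<one>\<^bsub>T r\<^esub> = f r \<one>\<^bsub>S r\<^esub>"
     "\<zero>\<^bsub>T r\<^esub> = f r \<zero>\<^bsub>S r\<^esub>" for r
    unfolding T_def by (rule transport_simps[OF f])+
  have T'': "\<lbrakk>x \<in> carrier (S r); y \<in> carrier (S r)\<rbrakk> \<Longrightarrow> f r x \<otimes>\<^bsub>T r\<^esub> f r y = f r (x \<otimes>\<^bsub>S r\<^esub> y)"
     "\<lbrakk>x \<in> carrier (S r); y \<in> carrier (S r)\<rbrakk> \<Longrightarrow> f r x \<oplus>\<^bsub>T r\<^esub> f r y = f r (x \<oplus>\<^bsub>S r\<^esub> y)"
     "x \<in> carrier (S r) \<Longrightarrow> c \<odot>\<^bsub>T r\<^esub> f r x = f r (c \<odot>\<^bsub>S r\<^esub> x)"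
     "x \<in> carrier (S r) \<Longrightarrow> nrm (T r) (f r x) = nrm (S r) x" for r x y c
    unfolding T_def by (rule transport_simps[OF f]; assumption)+
  note [simp] = T' T''
  have cl[simp]: "x \<in> carrier (S r) \<Longrightarrow> y \<in> carrier (S r) \<Longrightarrow> x \<otimes>\<^bsub>S r\<^esub> y \<in> carrier (S r)"
      "x \<in> carrier (S r) \<Longrightarrow> y \<in> carrier (S r) \<Longrightarrow> x \<oplus>\<^bsub>S r\<^esub> y \<in> carrier (S r)"
      "x \<in> carrier (S r) \<Longrightarrow> c \<odot>\<^bsub>S r\<^esub> x \<in> carrier (S r)"
      "\<one>\<^bsub>S r\<^esub> \<in> carrier (S r)" for x y c r
  proof -
    interpret unital_banach_algebra "S r" by (rule S)
    show "x \<in> carrier (S r) \<Longrightarrow> y \<in> carrier (S r) \<Longrightarrow> x \<otimes>\<^bsub>S r\<^esub> y \<in> carrier (S r)"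
      "x \<in> carrier (S r) \<Longrightarrow> y \<in> carrier (S r) \<Longrightarrow> x \<oplus>\<^bsub>S r\<^esub> y \<in> carrier (S r)"
      "x \<in> carrier (S r) \<Longrightarrow> c \<odot>\<^bsub>S r\<^esub> x \<in> carrier (S r)"
      "\<one>\<^bsub>S r\<^esub> \<in> carrier (S r)" by (auto intro: smult_carrier)
  qed
  have pc[simp]: "p r s x \<in> carrier (S r)" if "x \<in> carrier (S s)" "r \<le> s" for r s x
    using hom[OF that(2)] that(1) by (auto simp: unital_algebra_hom_def ring_hom_def)
  have q[simp]: "q r s (f s x) = f r (p r s x)" if "x \<in> carrier (S s)" for r s x
    using that by (simp add: q_def)
  have "admissible_system T q"
    unfolding admissible_system_def
  proof (intro conjI allI impI ballI)
    fix r
    show "unital_banach_algebra (T r)" "finite_dimensional (T r)"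
      unfolding T_def using S f
      by (auto intro: unital_banach_algebra_transport finite_dimensional_transport)
    show "nrm (T r) \<one>\<^bsub>T r\<^esub> = 1" using S by simp
  next
    fix r s :: nat assume rs: "r \<le> s"
    show "q r s \<in> unital_algebra_hom (T s) (T r)"
      using hom[OF rs] rs
      by (auto simp: unital_algebra_hom_def intro!: ring_hom_memI simp: ring_hom_def)
  next
    fix r x assume "x \<in> carrier (T r)"
    then show "q r r x = x" using adm by (auto simp: admissible_system_def)
  next
    fix r s t x assume "r \<le> s \<and> s \<le> t" "x \<in> carrier (T t)"
    then show "q r s (q s t x) = q r t x" using adm by (auto simp: admissible_system_def)
  next
    fix r s x assume rs: "r \<le> (s::nat)" and "x \<in> carrier (T r)"
    then obtain x' where x': "x' \<in> carrier (S r)" "x = f r x'" by auto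
    have ex: "\<exists>y\<in>carrier (S s). p r s y = x'"
      and inf: "nrm (S r) x' = Inf {nrm (S s) y | y. y \<in> carrier (S s) \<and> p r s y = x'}"
      using adm rs x' unfolding admissible_system_def by blast+
    show "\<exists>y\<in>carrier (T s). q r s y = x" using ex x' by auto
    have "{nrm (T s) y | y. y \<in> carrier (T s) \<and> q r s y = x} =
          {nrm (T s) (f s z) | z. z \<in> carrier (S s) \<and> q r s (f s z) = x}"
      by (simp add: image_iff) blast
    also have "\<dots> = {nrm (S s) y | y. y \<in> carrier (S s) \<and> p r s y = x'}"
      using x' rs by (intro Collect_cong ex_cong1) auto
    finally have "{nrm (T s) y | y. y \<in> carrier (T s) \<and> q r s y = x} =
          {nrm (S s) y | y. y \<in> carrier (S s) \<and> p r s y = x'}" .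
    then show "nrm (T r) x = Inf {nrm (T s) y | y. y \<in> carrier (T s) \<and> q r s y = x}"
      using x' inf by simp
  qed
  moreover have "isometrically_isomorphic A (bounded_inverse_limit T q)"
  proof -
    let ?L = "bounded_inverse_limit S p" and ?M = "bounded_inverse_limit T q"
    define k where "k = (\<lambda>a r. f r (a r))"
    from iso obtain h where h: "h \<in> unital_algebra_hom A ?L"
      "bij_betw h (carrier A) (carrier ?L)" "\<forall>x\<in>carrier A. nrm ?L (h x) = nrm A x"
      unfolding isometrically_isomorphic_def by blast
    have Lc: "a r \<in> carrier (S r)" if "a \<in> carrier ?L" for a r
      using that by (simp add: bounded_inverse_limit_def)
    have k: "k \<in> unital_algebra_hom ?L ?M"
      unfolding unital_algebra_hom_def
      by (auto intro!: ring_hom_memI imageI simp: bounded_inverse_limit_def k_def fun_eq_iff)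
    have kn: "nrm ?M (k a) = nrm ?L a" if "a \<in> carrier ?L" for a
      using Lc[OF that] by (simp add: bounded_inverse_limit_def k_def)
    have kb: "bij_betw k (carrier ?L) (carrier ?M)"
    proof (rule bij_betwI')
      fix x y assume "x \<in> carrier ?L" "y \<in> carrier ?L"
      then have "k x r = k y r \<longleftrightarrow> x r = y r" for r using Lc by (simp add: k_def)
      then show "(k x = k y) = (x = y)" by (metis ext)
    next
      fix x assume "x \<in> carrier ?L"
      then show "k x \<in> carrier ?M" using k by (auto simp: unital_algebra_hom_def ring_hom_def)
    next
      fix y assume y: "y \<in> carrier ?M"
      then have "\<forall>r. \<exists>z. z \<in> carrier (S r) \<and> y r = f r z"
        by (auto simp: bounded_inverse_limit_def image_iff Bex_def)
      then obtain z where z: "\<And>r. z r \<in> carrier (S r)" "\<And>r. y r = f r (z r)" by metis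
      have "z \<in> carrier ?L" using y z by (auto simp: bounded_inverse_limit_def)
      moreover have "y = k z" using z by (auto simp: k_def)
      ultimately show "\<exists>x\<in>carrier ?L. y = k x" by blast
    qed
    have hc: "h x \<in> carrier ?L" if "x \<in> carrier A" for x
      using h(2) that by (auto simp: bij_betw_def)
    have "k \<circ> h \<in> unital_algebra_hom A ?M"
      using k h(1) hc ring_hom_trans[of h A ?L k ?M] by (auto simp: unital_algebra_hom_def)
    moreover have "bij_betw (k \<circ> h) (carrier A) (carrier ?M)"
      using h(2) kb by (rule bij_betw_trans)
    moreover have "\<forall>x\<in>carrier A. nrm ?M ((k \<circ> h) x) = nrm A x"
      using kn hc h(3) by simp
    ultimately show ?thesis unfolding isometrically_isomorphic_def by blast
  qed
  ultimately show ?thesis unfolding is_bounded_inverse_limit_def by blast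
qed


section \<open>Schauder bases\<close>

text \<open>
  A Banach space over \<open>'k\<close> is a type of class \<^class>\<open>banach\<close> (a real Banach space) together with a
  compatible multiplication by scalars from \<open>'k\<close>. Bases are indexed from 0.
\<close>

locale banach_space_over = vector_space smul
  for smul :: "'k::real_or_complex \<Rightarrow> 'u::banach \<Rightarrow> 'u" +
  assumes norm_scale: "norm (smul c x) = norm c * norm x"
    and scale_of_real: "smul (of_real t) x = t *\<^sub>R x"

definition schauder_basis ::
  "('k::real_or_complex \<Rightarrow> 'u::banach \<Rightarrow> 'u) \<Rightarrow> (nat \<Rightarrow> 'u) \<Rightarrow> bool" where
  "schauder_basis smul u \<longleftrightarrow> (\<forall>x. \<exists>!a. (\<lambda>n. smul (a n) (u n)) sums x)"

definition normalized_basis :: "(nat \<Rightarrow> 'u::banach) \<Rightarrow> bool" where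
  "normalized_basis u \<longleftrightarrow> (\<forall>n. norm (u n) = 1)"

definition one_unconditional ::
  "('k::real_or_complex \<Rightarrow> 'u::banach \<Rightarrow> 'u) \<Rightarrow> (nat \<Rightarrow> 'u) \<Rightarrow> bool" where
  "one_unconditional smul u \<longleftrightarrow>
     (\<forall>a b. finite {n. a n \<noteq> 0} \<and> finite {n. b n \<noteq> 0} \<and> (\<forall>n. norm (a n) \<le> norm (b n)) \<longrightarrow>
        norm (\<Sum>n | a n \<noteq> 0. smul (a n) (u n)) \<le> norm (\<Sum>n | b n \<noteq> 0. smul (b n) (u n)))"

definition boundedly_complete ::
  "('k::real_or_complex \<Rightarrow> 'u::banach \<Rightarrow> 'u) \<Rightarrow> (nat \<Rightarrow> 'u) \<Rightarrow> bool" where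
  "boundedly_complete smul u \<longleftrightarrow>
     (\<forall>a. bdd_above (range (\<lambda>N. norm (\<Sum>n\<le>N. smul (a n) (u n)))) \<longrightarrow>
        summable (\<lambda>n. smul (a n) (u n)))"


section \<open>The unitization of a direct sum along a basis\<close>

text \<open>
  The algebras \<open>B n\<close> have a common element type but independent carriers and operations; any
  sequence of algebras arises in this way, inside the disjoint union of its members.
\<close>

definition dsum_carrier ::
  "(nat \<Rightarrow> 'u::banach) \<Rightarrow> (nat \<Rightarrow> ('k::real_or_complex, 'b) normed_algebra) \<Rightarrow> (nat \<Rightarrow> 'b) set" where
  "dsum_carrier u B =
     {b. (\<forall>n. b n \<in> carrier (B n)) \<and> summable (\<lambda>n. nrm (B n) (b n) *\<^sub>R u n)}"

definition dsum_norm ::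
  "(nat \<Rightarrow> 'u::banach) \<Rightarrow> (nat \<Rightarrow> ('k::real_or_complex, 'b) normed_algebra) \<Rightarrow> (nat \<Rightarrow> 'b) \<Rightarrow> real" where
  "dsum_norm u B b = norm (\<Sum>n. nrm (B n) (b n) *\<^sub>R u n)"

text \<open>The pair \<open>(b, l)\<close> stands for $b + l I$.\<close>

definition dsum_unitization ::
  "(nat \<Rightarrow> 'u::banach) \<Rightarrow> (nat \<Rightarrow> ('k::real_or_complex, 'b) normed_algebra) \<Rightarrow>
   ('k, (nat \<Rightarrow> 'b) \<times> 'k) normed_algebra" where
  "dsum_unitization u B =
     \<lparr>carrier = dsum_carrier u B \<times> UNIV,
      monoid.mult = (\<lambda>(b, l) (c, m).
        (\<lambda>n. b n \<otimes>\<^bsub>B n\<^esub> c n \<oplus>\<^bsub>B n\<^esub> l \<odot>\<^bsub>B n\<^esub> c n \<oplus>\<^bsub>B n\<^esub> m \<odot>\<^bsub>B n\<^esub> b n, l * m)),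
      one = (\<lambda>n. \<zero>\<^bsub>B n\<^esub>, 1),
      zero = (\<lambda>n. \<zero>\<^bsub>B n\<^esub>, 0),
      add = (\<lambda>(b, l) (c, m). (\<lambda>n. b n \<oplus>\<^bsub>B n\<^esub> c n, l + m)),
      smult = (\<lambda>t (b, l). (\<lambda>n. t \<odot>\<^bsub>B n\<^esub> b n, t * l)),
      nrm = (\<lambda>(b, l). dsum_norm u B b + norm l)\<rparr>"

end

(*
If a bounded inverse limit A contains an idempotent e of norm 1, then e A e is the bounded inverse
limit of the corners of the coordinates of e. This applies to the unit of the summand B_n. The basis
is boundedly complete because only finitely many of the orthogonal units of the summands survive in a
finite-dimensional quotient: a bounded sequence of diagonal elements sum_{k<=N} c_k 1_{B_k} is
eventually constant in every quotient and has a limit b + l I of norm at most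
C = sup_N ||sum_{k<=N} |c_k| u_k||, where b_k = (c_k - l) 1. Taking c_k = -|a_k| for k < M and
c_k = |a_k| otherwise gives l = lim |a_k| and ||sum_{k<M} |a_k| u_k|| + l <= C; since M is
arbitrary, l = 0 and sum |a_k| u_k converges.

Conversely, if B_n is the bounded inverse limit of (S_{n,r})_r, then A is the bounded inverse limit
of the truncations (S_{0,r} + ... + S_{r-1,r})_U + K I; bounded completeness is what makes a
bounded compatible sequence come from an element of A.
*)
theory Submission
  imports Defs "HOL-Library.Function_Algebras"
begin

section \<open>Normalized 1-unconditional sequences\<close>

text \<open>The difficulty in the forward direction is the scalar part l of a coordinatewise limit.
  Take the unit vectors of c_0 and a_k = 1: the partial sums of the units are bounded by C = 1, but
  their limit may be I itself, with b = 0, l = 1 and norm 1, so the bound alone excludes nothing.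
  With -1 in front of M the scalar part is still 1, but now b_k = -2 for k < M. The two parts no
  longer compensate each other, and the norm of A adds them. This gain is turned into l = 0 by
  letting C be the least bound instead of any bound. Passing to corners preserves quotient norms
  because a nonzero idempotent of norm at most 1 has norm exactly 1. Compressing an approximate lift
  y to e y e then does not increase its norm, and it still lifts the same element of the corner. In
  the converse direction the cutoff in the sum and the level in each summand are the same index r.
  An entry (n, r) with r \<le> n is therefore invisible at stage r and has to be recovered from a
  later stage.\<close>

locale normalized_unconditional = banach_space_over smul
  for smul :: "'k::real_or_complex \<Rightarrow> 'u::banach \<Rightarrow> 'u" +
  fixes u :: "nat \<Rightarrow> 'u"
  assumes normalized: "normalized_basis u"
    and unconditional: "one_unconditional smul u"
begin

lemma norm_u [simp]: "norm (u n) = 1"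
  using normalized by (simp add: normalized_basis_def)

lemma norm_sum_smul_mono:
  assumes F: "finite F" and le: "\<And>n. n \<in> F \<Longrightarrow> norm (a n) \<le> norm (b n)"
  shows "norm (\<Sum>n\<in>F. smul (a n) (u n)) \<le> norm (\<Sum>n\<in>F. smul (b n) (u n))"
proof -
  \<comment> \<open>\<open>one_unconditional\<close> sums over supports, which need not agree for a
    and b. After cutting to F, both sums become sums over F by adding zero terms.\<close>
  define cut where "cut = (\<lambda>(c :: nat \<Rightarrow> 'k) n. if n \<in> F then c n else 0)"
  have supp: "{n. cut c n \<noteq> 0} \<subseteq> F" for c by (auto simp: cut_def)
  then have fin: "finite {n. cut c n \<noteq> 0}" for c using F finite_subset by blast
  have sum: "(\<Sum>n | cut c n \<noteq> 0. smul (cut c n) (u n)) = (\<Sum>n\<in>F. smul (c n) (u n))" for c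
    by (rule sum.mono_neutral_cong_left[OF F supp]) (auto simp: cut_def)
  have "\<forall>n. norm (cut a n) \<le> norm (cut b n)" using le by (simp add: cut_def)
  with unconditional[unfolded one_unconditional_def, rule_format, of "cut a" "cut b"] fin
  show ?thesis unfolding sum by simp
qed

text \<open>A scalar and its modulus dominate each other, so monotonicity applies in both
  directions. From here on real coefficients suffice.\<close>

lemma norm_sum_smul:
  assumes "finite F"
  shows "norm (\<Sum>n\<in>F. smul (a n) (u n)) = norm (\<Sum>n\<in>F. norm (a n) *\<^sub>R u n)"
proof -
  have "norm (\<Sum>n\<in>F. smul (a n) (u n)) = norm (\<Sum>n\<in>F. smul (of_real (norm (a n))) (u n))"
    by (intro antisym norm_sum_smul_mono assms) simp_all
  then show ?thesis by (simp add: scale_of_real)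
qed

lemma norm_sum_mono:
  assumes "finite F" "\<And>n. n \<in> F \<Longrightarrow> \<bar>\<alpha> n\<bar> \<le> \<bar>\<beta> n\<bar>"
  shows "norm (\<Sum>n\<in>F. \<alpha> n *\<^sub>R u n) \<le> norm (\<Sum>n\<in>F. \<beta> n *\<^sub>R u n)"
  using norm_sum_smul_mono[OF assms(1), of "\<lambda>n. of_real (\<alpha> n)" "\<lambda>n. of_real (\<beta> n)"] assms(2)
  by (simp add: scale_of_real)

lemma norm_sum_subset_mono:
  assumes "finite G" "F \<subseteq> G"
  shows "norm (\<Sum>n\<in>F. \<alpha> n *\<^sub>R u n) \<le> norm (\<Sum>n\<in>G. \<alpha> n *\<^sub>R u n)"
proof -
  have "(\<Sum>n\<in>F. \<alpha> n *\<^sub>R u n) = (\<Sum>n\<in>G. (if n \<in> F then \<alpha> n else 0) *\<^sub>R u n)"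
    using assms by (intro sum.mono_neutral_cong_left) auto
  then show ?thesis using norm_sum_mono[OF assms(1), of "\<lambda>n. if n \<in> F then \<alpha> n else 0" \<alpha>] by simp
qed

lemma summable_mono:
  assumes "summable (\<lambda>n. \<beta> n *\<^sub>R u n)" "\<And>n. \<bar>\<alpha> n\<bar> \<le> \<bar>\<beta> n\<bar>"
  shows "summable (\<lambda>n. \<alpha> n *\<^sub>R u n)"
  unfolding summable_Cauchy
proof (intro allI impI)
  fix e :: real assume "0 < e"
  then obtain N where N: "\<And>m n. N \<le> m \<Longrightarrow> norm (\<Sum>k=m..<n. \<beta> k *\<^sub>R u k) < e"
    using assms(1) unfolding summable_Cauchy by blast
  have "norm (\<Sum>k=m..<n. \<alpha> k *\<^sub>R u k) < e" if "N \<le> m" for m n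
    using norm_sum_mono[of "{m..<n}" \<alpha> \<beta>] assms(2) N[OF that, of n] by simp
  then show "\<exists>N. \<forall>m\<ge>N. \<forall>n. norm (\<Sum>k=m..<n. \<alpha> k *\<^sub>R u k) < e" by blast
qed

lemma summable_smul:
  assumes "summable (\<lambda>n. norm (a n) *\<^sub>R u n)"
  shows "summable (\<lambda>n. smul (a n) (u n))"
  using assms unfolding summable_Cauchy by (simp add: norm_sum_smul)

lemma summable_combination:
  assumes "summable (\<lambda>n. \<alpha> n *\<^sub>R u n)" "summable (\<lambda>n. \<beta> n *\<^sub>R u n)"
    and "\<And>n. \<bar>\<gamma> n\<bar> \<le> s * \<bar>\<alpha> n\<bar> + t * \<bar>\<beta> n\<bar>"
  shows "summable (\<lambda>n. \<gamma> n *\<^sub>R u n)"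
proof -
  have "summable (\<lambda>n. \<bar>\<alpha> n\<bar> *\<^sub>R u n)" "summable (\<lambda>n. \<bar>\<beta> n\<bar> *\<^sub>R u n)"
    by (rule summable_mono[OF assms(1)], simp, rule summable_mono[OF assms(2)], simp)
  then have "summable (\<lambda>n. s *\<^sub>R (\<bar>\<alpha> n\<bar> *\<^sub>R u n) + t *\<^sub>R (\<bar>\<beta> n\<bar> *\<^sub>R u n))"
    by (intro summable_add summable_scaleR_right)
  then have "summable (\<lambda>n. (s * \<bar>\<alpha> n\<bar> + t * \<bar>\<beta> n\<bar>) *\<^sub>R u n)"
    by (simp add: scaleR_left_distrib)
  then show ?thesis by (rule summable_mono) (rule order_trans[OF assms(3) abs_ge_self])
qed

lemma norm_sum_le_suminf:
  assumes "summable (\<lambda>n. \<alpha> n *\<^sub>R u n)" "finite F"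
  shows "norm (\<Sum>n\<in>F. \<alpha> n *\<^sub>R u n) \<le> norm (\<Sum>n. \<alpha> n *\<^sub>R u n)"
proof (rule LIMSEQ_le_const)
  show "(\<lambda>N. norm (\<Sum>n<N. \<alpha> n *\<^sub>R u n)) \<longlonglongrightarrow> norm (\<Sum>n. \<alpha> n *\<^sub>R u n)"
    using assms(1) by (intro tendsto_norm summable_LIMSEQ)
  obtain M where M: "F \<subseteq> {..<M}" using finite_nat_bounded[OF assms(2)] by blast
  show "\<exists>N. \<forall>n\<ge>N. norm (\<Sum>k\<in>F. \<alpha> k *\<^sub>R u k) \<le> norm (\<Sum>k<n. \<alpha> k *\<^sub>R u k)"
  proof (intro exI[of _ M] allI impI norm_sum_subset_mono)
    fix n assume "M \<le> n"
    then show "F \<subseteq> {..<n}" using M by (auto dest!: subsetD)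
  qed simp
qed

lemma norm_suminf_le:
  assumes "summable (\<lambda>n. \<alpha> n *\<^sub>R u n)" "\<And>N. norm (\<Sum>n<N. \<alpha> n *\<^sub>R u n) \<le> C"
  shows "norm (\<Sum>n. \<alpha> n *\<^sub>R u n) \<le> C"
  by (rule LIMSEQ_le_const2[OF tendsto_norm[OF summable_LIMSEQ[OF assms(1)]]]) (use assms(2) in auto)

lemma abs_le_norm_suminf:
  assumes "summable (\<lambda>n. \<alpha> n *\<^sub>R u n)"
  shows "\<bar>\<alpha> n\<bar> \<le> norm (\<Sum>n. \<alpha> n *\<^sub>R u n)"
  using norm_sum_le_suminf[OF assms, of "{n}"] by simp

lemma abs_le_norm_sum:
  assumes "finite F" "n \<in> F"
  shows "\<bar>\<alpha> n\<bar> \<le> norm (\<Sum>n\<in>F. \<alpha> n *\<^sub>R u n)"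
  using norm_sum_subset_mono[of F "{n}" \<alpha>] assms by simp

lemma tendsto_zero_if_summable:
  assumes "summable (\<lambda>n. \<alpha> n *\<^sub>R u n)"
  shows "\<alpha> \<longlonglongrightarrow> 0"
  using tendsto_norm_zero[OF summable_LIMSEQ_zero[OF assms]] by (simp add: tendsto_rabs_zero_iff)

lemma boundedly_completeD:
  assumes "boundedly_complete smul u" "\<And>N. norm (\<Sum>n<N. \<alpha> n *\<^sub>R u n) \<le> C"
  shows "summable (\<lambda>n. \<alpha> n *\<^sub>R u n)"
proof -
  have "bdd_above (range (\<lambda>N. norm (\<Sum>n\<le>N. smul (of_real (\<alpha> n)) (u n))))"
    using assms(2)[of "Suc N" for N]
    by (intro bdd_aboveI[of _ C]) (auto simp: scale_of_real lessThan_Suc_atMost)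
  then show ?thesis
    using assms(1)[unfolded boundedly_complete_def, rule_format, of "\<lambda>n. of_real (\<alpha> n)"]
    by (simp add: scale_of_real)
qed

text \<open>The parameters s and t let one estimate cover sums, scalar multiples and products in the
  direct sum.\<close>

lemma norm_suminf_le_combination:
  assumes "summable (\<lambda>n. \<alpha> n *\<^sub>R u n)" "summable (\<lambda>n. \<beta> n *\<^sub>R u n)"
    and \<gamma>: "\<And>n. \<bar>\<gamma> n\<bar> \<le> s * \<bar>\<alpha> n\<bar> + t * \<bar>\<beta> n\<bar>" and st: "0 \<le> s" "0 \<le> t"
  shows "norm (\<Sum>n. \<gamma> n *\<^sub>R u n) \<le>
    s * norm (\<Sum>n. \<alpha> n *\<^sub>R u n) + t * norm (\<Sum>n. \<beta> n *\<^sub>R u n)"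
proof (rule norm_suminf_le)
  show "summable (\<lambda>n. \<gamma> n *\<^sub>R u n)" by (rule summable_combination[OF assms(1,2) \<gamma>])
  fix N
  have "norm (\<Sum>n<N. \<gamma> n *\<^sub>R u n) \<le> norm (\<Sum>n<N. (s * \<bar>\<alpha> n\<bar> + t * \<bar>\<beta> n\<bar>) *\<^sub>R u n)"
    using \<gamma> by (intro norm_sum_mono) (auto intro: order_trans[OF _ abs_ge_self])
  also have "\<dots> = norm (s *\<^sub>R (\<Sum>n<N. \<bar>\<alpha> n\<bar> *\<^sub>R u n) + t *\<^sub>R (\<Sum>n<N. \<bar>\<beta> n\<bar> *\<^sub>R u n))"
    by (simp add: scaleR_left_distrib sum.distrib scaleR_right.sum)
  also have "\<dots> \<le> s * norm (\<Sum>n<N. \<bar>\<alpha> n\<bar> *\<^sub>R u n) + t * norm (\<Sum>n<N. \<bar>\<beta> n\<bar> *\<^sub>R u n)"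
    using st by (intro norm_triangle_le) simp
  also have "\<dots> \<le> s * norm (\<Sum>n. \<alpha> n *\<^sub>R u n) + t * norm (\<Sum>n. \<beta> n *\<^sub>R u n)"
  proof (intro add_mono mult_left_mono st)
    show "norm (\<Sum>n<N. \<bar>\<alpha> n\<bar> *\<^sub>R u n) \<le> norm (\<Sum>n. \<alpha> n *\<^sub>R u n)"
      by (rule order_trans[OF norm_sum_mono norm_sum_le_suminf[OF assms(1), of "{..<N}"]]) simp_all
    show "norm (\<Sum>n<N. \<bar>\<beta> n\<bar> *\<^sub>R u n) \<le> norm (\<Sum>n. \<beta> n *\<^sub>R u n)"
      by (rule order_trans[OF norm_sum_mono norm_sum_le_suminf[OF assms(2), of "{..<N}"]]) simp_all
  qed
  finally show "norm (\<Sum>n<N. \<gamma> n *\<^sub>R u n) \<le> \<dots>" .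
qed

text \<open>Gives membership of a limit in the direct sum: a block of \<alpha> is a block of
  \<alpha> - \<beta>, which is uniformly small, plus a block of \<beta>, which is small far
  out.\<close>

lemma summable_if_approximable:
  assumes "\<And>\<epsilon>. \<epsilon> > 0 \<Longrightarrow> \<exists>\<beta>. summable (\<lambda>n. \<beta> n *\<^sub>R u n) \<and>
    (\<forall>F. finite F \<longrightarrow> norm (\<Sum>n\<in>F. (\<alpha> n - \<beta> n) *\<^sub>R u n) \<le> \<epsilon>)"
  shows "summable (\<lambda>n. \<alpha> n *\<^sub>R u n)"
  unfolding summable_Cauchy
proof (intro allI impI)
  fix e :: real assume "0 < e"
  then obtain \<beta> where \<beta>: "summable (\<lambda>n. \<beta> n *\<^sub>R u n)"
    and approx: "\<And>F. finite F \<Longrightarrow> norm (\<Sum>n\<in>F. (\<alpha> n - \<beta> n) *\<^sub>R u n) \<le> e / 2"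
    using assms[of "e / 2"] by auto
  obtain N where N: "\<And>m n. N \<le> m \<Longrightarrow> norm (\<Sum>k=m..<n. \<beta> k *\<^sub>R u k) < e / 2"
    using \<beta> \<open>0 < e\<close> unfolding summable_Cauchy by (meson half_gt_zero)
  have "norm (\<Sum>k=m..<n. \<alpha> k *\<^sub>R u k) < e" if "N \<le> m" for m n
  proof -
    have "(\<Sum>k=m..<n. \<alpha> k *\<^sub>R u k) =
        (\<Sum>k=m..<n. (\<alpha> k - \<beta> k) *\<^sub>R u k) + (\<Sum>k=m..<n. \<beta> k *\<^sub>R u k)"
      by (simp add: sum.distrib[symmetric] scaleR_left_distrib[symmetric])
    then show ?thesis
      using norm_triangle_ineq[of "\<Sum>k=m..<n. (\<alpha> k - \<beta> k) *\<^sub>R u k" "\<Sum>k=m..<n. \<beta> k *\<^sub>R u k"]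
        approx[of "{m..<n}"] N[OF that, of n] by simp
  qed
  then show "\<exists>N. \<forall>m\<ge>N. \<forall>n. norm (\<Sum>k=m..<n. \<alpha> k *\<^sub>R u k) < e" by blast
qed

text \<open>Length and coefficients change together with r. The limit is an upper bound by
  monotonicity; for the lower bound the length is frozen at some N, where only finitely many
  coefficients have to converge.\<close>

lemma tendsto_norm_truncated_sum:
  assumes summable: "summable (\<lambda>n. \<beta> n *\<^sub>R u n)"
    and le: "\<And>r n. \<bar>\<alpha> r n\<bar> \<le> \<bar>\<beta> n\<bar>" and lim: "\<And>n. (\<lambda>r. \<alpha> r n) \<longlonglongrightarrow> \<beta> n"
  shows "(\<lambda>r. norm (\<Sum>n<r. \<alpha> r n *\<^sub>R u n)) \<longlonglongrightarrow> norm (\<Sum>n. \<beta> n *\<^sub>R u n)"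
proof (rule order_tendstoI)
  fix t assume "norm (\<Sum>n. \<beta> n *\<^sub>R u n) < t"
  moreover have "norm (\<Sum>n<r. \<alpha> r n *\<^sub>R u n) \<le> norm (\<Sum>n. \<beta> n *\<^sub>R u n)" for r
    by (rule order_trans[OF norm_sum_mono norm_sum_le_suminf[OF summable, of "{..<r}"]]) (auto simp: le)
  ultimately show "\<forall>\<^sub>F r in sequentially. norm (\<Sum>n<r. \<alpha> r n *\<^sub>R u n) < t"
    by (intro always_eventually) (auto intro: le_less_trans)
next
  fix t assume t: "t < norm (\<Sum>n. \<beta> n *\<^sub>R u n)"
  have "\<forall>\<^sub>F N in sequentially. t < norm (\<Sum>n<N. \<beta> n *\<^sub>R u n)"
    by (rule order_tendstoD(1)[OF tendsto_norm[OF summable_LIMSEQ[OF summable]] t])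
  then obtain N where N: "t < norm (\<Sum>n<N. \<beta> n *\<^sub>R u n)"
    by (auto simp: eventually_sequentially)
  have "(\<lambda>r. norm (\<Sum>n<N. \<alpha> r n *\<^sub>R u n)) \<longlonglongrightarrow> norm (\<Sum>n<N. \<beta> n *\<^sub>R u n)"
    by (intro tendsto_intros lim)
  then have "\<forall>\<^sub>F r in sequentially. t < norm (\<Sum>n<N. \<alpha> r n *\<^sub>R u n)"
    using N by (rule order_tendstoD(1))
  then show "\<forall>\<^sub>F r in sequentially. t < norm (\<Sum>n<r. \<alpha> r n *\<^sub>R u n)"
    using eventually_ge_at_top[of N]
  proof eventually_elim
    case (elim r)
    then show ?case using norm_sum_subset_mono[of "{..<r}" "{..<N}" "\<alpha> r"] by simp
  qed
qed

end

section \<open>Linear spans and corner algebras\<close>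

context unital_banach_algebra
begin

section \<open>Scalar and norm identities, linear spans\<close>

lemma smult_zero_left: "x \<in> carrier A \<Longrightarrow> 0 \<odot> x = \<zero>"
  using nrm_smult[of x 0] nrm_eq_0_iff[of "0 \<odot> x"] smult_carrier by simp

lemma nrm_zero [simp]: "nrm A \<zero> = 0"
  using nrm_eq_0_iff by simp

lemma smult_zero_right [simp]: "c \<odot> \<zero> = \<zero>"
  using nrm_smult[of \<zero> c] nrm_eq_0_iff[of "c \<odot> \<zero>"] smult_carrier by simp

lemma a_inv_eq_smult: "x \<in> carrier A \<Longrightarrow> \<ominus> x = (- 1) \<odot> x"
  using smult_laws(1)[of x "- 1" 1] smult_laws(4)[of x] smult_zero_left[of x] smult_carrier
  by (intro minus_equality) simp_all

lemma nrm_a_inv: "x \<in> carrier A \<Longrightarrow> nrm A (\<ominus> x) = nrm A x"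
  by (simp add: a_inv_eq_smult nrm_smult)

lemma nrm_minus_le:
  "x \<in> carrier A \<Longrightarrow> y \<in> carrier A \<Longrightarrow> nrm A (x \<ominus> y) \<le> nrm A x + nrm A y"
  using nrm_triangle[of x "\<ominus> y"] by (simp add: a_minus_def nrm_a_inv)

lemma abs_nrm_diff_le:
  assumes "x \<in> carrier A" "y \<in> carrier A"
  shows "\<bar>nrm A x - nrm A y\<bar> \<le> nrm A (x \<ominus> y)"
proof -
  have "x = y \<oplus> (x \<ominus> y)" "y = x \<ominus> (x \<ominus> y)"
    using assms by (simp_all add: a_minus_def minus_add r_neg r_neg2 a_lcomm[of y x])
  then have "nrm A x \<le> nrm A y + nrm A (x \<ominus> y)" "nrm A y \<le> nrm A x + nrm A (x \<ominus> y)"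
    using assms nrm_triangle[of y "x \<ominus> y"] nrm_minus_le[of x "x \<ominus> y"] by auto
  then show ?thesis by linarith
qed

lemma diff_diff_cancel_left:
  assumes "x \<in> carrier A" "y \<in> carrier A" "z \<in> carrier A"
  shows "(x \<ominus> y) \<ominus> (x \<ominus> z) = z \<ominus> y"
  using assms by (simp add: a_minus_def minus_add r_neg1 r_neg2 a_ac)

text \<open>Uses the same combinations as \<open>finite_dimensional\<close>: over a finite S they
  form the linear span, elements left out having coefficient 0.\<close>

definition lin_span :: "'a set \<Rightarrow> 'a set" where
  "lin_span S = {\<Oplus>s\<in>S. c s \<odot> s | c. True}"

lemma lin_span_iff: "x \<in> lin_span S \<longleftrightarrow> (\<exists>c. x = (\<Oplus>s\<in>S. c s \<odot> s))"
  by (simp add: lin_span_def)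

lemma finite_dimensional_iff:
  "finite_dimensional A \<longleftrightarrow> (\<exists>S. finite S \<and> S \<subseteq> carrier A \<and> carrier A \<subseteq> lin_span S)"
  unfolding finite_dimensional_def by (simp add: subset_eq lin_span_iff)

lemma lin_span_zero: "S \<subseteq> carrier A \<Longrightarrow> \<zero> \<in> lin_span S"
proof -
  assume S: "S \<subseteq> carrier A"
  have "(\<Oplus>s\<in>S. 0 \<odot> s) = (\<Oplus>s\<in>S. \<zero>)"
    by (rule finsum_cong') (use S smult_zero_left in auto)
  then show ?thesis unfolding lin_span_def by (auto intro!: exI[of _ "\<lambda>_. 0"])
qed

lemma lin_span_add:
  assumes S: "S \<subseteq> carrier A" and "x \<in> lin_span S" "y \<in> lin_span S"
  shows "x \<oplus> y \<in> lin_span S"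
proof -
  obtain c d where c: "x = (\<Oplus>s\<in>S. c s \<odot> s)" and d: "y = (\<Oplus>s\<in>S. d s \<odot> s)"
    using assms unfolding lin_span_def by blast
  have "x \<oplus> y = (\<Oplus>s\<in>S. c s \<odot> s \<oplus> d s \<odot> s)"
    unfolding c d using S smult_carrier by (subst finsum_addf) auto
  also have "\<dots> = (\<Oplus>s\<in>S. (c s + d s) \<odot> s)"
    using S smult_carrier smult_laws(1) by (intro finsum_cong') auto
  finally show ?thesis unfolding lin_span_def by (auto intro!: exI[of _ "\<lambda>s. c s + d s"])
qed

lemma lin_span_smult:
  assumes S: "finite S" "S \<subseteq> carrier A" and "x \<in> lin_span S"
  shows "t \<odot> x \<in> lin_span S"
proof -
  obtain c where c: "x = (\<Oplus>s\<in>S. c s \<odot> s)"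
    using assms unfolding lin_span_def by blast
  have "t \<odot> x = (\<Oplus>s\<in>S. t \<odot> (c s \<odot> s))"
    unfolding c using S smult_carrier
    by (intro scalars.finsum_smult_ldistr) (auto simp: scalar_ring_def)
  also have "\<dots> = (\<Oplus>s\<in>S. (t * c s) \<odot> s)"
    using S smult_carrier smult_laws(3) by (intro finsum_cong') auto
  finally show ?thesis unfolding lin_span_def by (auto intro!: exI[of _ "\<lambda>s. t * c s"])
qed

lemma lin_span_base:
  assumes S: "finite S" "S \<subseteq> carrier A" and s: "s \<in> S"
  shows "s \<in> lin_span S"
proof -
  have "(\<Oplus>r\<in>S. (if s = r then 1 else 0) \<odot> r) = (\<Oplus>r\<in>S. if s = r then r else \<zero>)"
    using S smult_zero_left smult_laws(4) by (intro finsum_cong') auto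
  also have "\<dots> = s"
    using S s by (intro add.finprod_singleton) auto
  finally show ?thesis
    unfolding lin_span_iff by (intro exI[of _ "\<lambda>r. if s = r then 1 else 0"]) simp
qed

end

text \<open>Proved by closure of the span under the operations rather than by reindexing the sum
  along T, so T may identify elements of S.\<close>

lemma linear_image_lin_span:
  assumes A: "unital_banach_algebra A" and B: "unital_banach_algebra B"
    and T: "\<And>x. x \<in> carrier A \<Longrightarrow> T x \<in> carrier B"
    and add: "\<And>x y. x \<in> carrier A \<Longrightarrow> y \<in> carrier A \<Longrightarrow> T (x \<oplus>\<^bsub>A\<^esub> y) = T x \<oplus>\<^bsub>B\<^esub> T y"
    and smult: "\<And>c x. x \<in> carrier A \<Longrightarrow> T (c \<odot>\<^bsub>A\<^esub> x) = c \<odot>\<^bsub>B\<^esub> T x"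
    and S: "finite S" "S \<subseteq> carrier A" "x \<in> unital_banach_algebra.lin_span A S"
    and S': "finite S'" "S' \<subseteq> carrier B" "T ` S \<subseteq> S'"
  shows "T x \<in> unital_banach_algebra.lin_span B S'"
proof -
  interpret A: unital_banach_algebra A by (rule A)
  interpret B: unital_banach_algebra B by (rule B)
  obtain c where c: "x = (\<Oplus>\<^bsub>A\<^esub>s\<in>S. c s \<odot>\<^bsub>A\<^esub> s)"
    using S(3) unfolding A.lin_span_def by blast
  have zero: "T \<zero>\<^bsub>A\<^esub> = \<zero>\<^bsub>B\<^esub>"
    using smult[of "\<zero>\<^bsub>A\<^esub>" 0] T by (simp add: B.smult_zero_left)
  have "T (\<Oplus>\<^bsub>A\<^esub>s\<in>F. c s \<odot>\<^bsub>A\<^esub> s) \<in> B.lin_span S'" if "F \<subseteq> S" for F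
    using finite_subset[OF that S(1)] that
  proof (induction F rule: finite_induct)
    case empty
    then show ?case using zero B.lin_span_zero[OF S'(2)] by simp
  next
    case (insert s F)
    have F: "(\<lambda>s. c s \<odot>\<^bsub>A\<^esub> s) \<in> F \<rightarrow> carrier A" and s: "s \<in> carrier A"
      using insert.prems S(2) A.smult_carrier by auto
    have "T s \<in> B.lin_span S'"
      using S' insert.prems by (intro B.lin_span_base) auto
    then have "c s \<odot>\<^bsub>B\<^esub> T s \<oplus>\<^bsub>B\<^esub> T (\<Oplus>\<^bsub>A\<^esub>s\<in>F. c s \<odot>\<^bsub>A\<^esub> s) \<in> B.lin_span S'"
      using insert by (intro B.lin_span_add B.lin_span_smult S') auto
    then show ?case
      using insert.hyps F s by (simp add: A.finsum_insert add smult A.smult_carrier A.finsum_closed)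
  qed
  then show ?thesis unfolding c by blast
qed

text \<open>
  The corner \<open>e A e\<close>. For \<open>e = \<one>\<close> it is \<open>A\<close> itself and for \<open>e = \<zero>\<close> it is the zero algebra, so
  truncated direct sums are obtained by replacing some of the summands by corners.
\<close>

definition corner ::
  "('k::real_or_complex, 'a, 'm) normed_algebra_scheme \<Rightarrow> 'a \<Rightarrow> ('k, 'a, 'm) normed_algebra_scheme"
  where "corner A e =
    A\<lparr>carrier := {x \<in> carrier A. e \<otimes>\<^bsub>A\<^esub> x = x \<and> x \<otimes>\<^bsub>A\<^esub> e = x}, one := e\<rparr>"

lemma corner_simps [simp]:
  "carrier (corner A e) = {x \<in> carrier A. e \<otimes>\<^bsub>A\<^esub> x = x \<and> x \<otimes>\<^bsub>A\<^esub> e = x}"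
  "\<one>\<^bsub>corner A e\<^esub> = e" "\<zero>\<^bsub>corner A e\<^esub> = \<zero>\<^bsub>A\<^esub>"
  "x \<otimes>\<^bsub>corner A e\<^esub> y = x \<otimes>\<^bsub>A\<^esub> y" "x \<oplus>\<^bsub>corner A e\<^esub> y = x \<oplus>\<^bsub>A\<^esub> y"
  "c \<odot>\<^bsub>corner A e\<^esub> x = c \<odot>\<^bsub>A\<^esub> x" "nrm (corner A e) x = nrm A x"
  by (simp_all add: corner_def)

context unital_banach_algebra
begin

text \<open>Only completeness needs an idea: the two multiplications by e are bounded and fix every
  \<open>X n\<close>, hence they also fix the limit.\<close>

lemma corner_banach_algebra:
  assumes e: "e \<in> carrier A" "e \<otimes> e = e"
  shows "unital_banach_algebra (corner A e)"
proof -
  note [simp] = smult_carrier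
  have ab: "abelian_group (corner A e)"
  proof (rule abelian_groupI)
    fix x assume "x \<in> carrier (corner A e)"
    then show "\<exists>y\<in>carrier (corner A e). y \<oplus>\<^bsub>corner A e\<^esub> x = \<zero>\<^bsub>corner A e\<^esub>"
      using e by (intro bexI[of _ "\<ominus> x"]) (auto simp: l_neg r_minus l_minus)
  qed (use e in \<open>auto simp: a_ac l_distr r_distr\<close>)
  have mon: "monoid (corner A e)"
  proof (rule monoidI)
    fix x y assume "x \<in> carrier (corner A e)" "y \<in> carrier (corner A e)"
    then show "x \<otimes>\<^bsub>corner A e\<^esub> y \<in> carrier (corner A e)"
      using e by (auto simp: m_assoc) (metis m_assoc)
  qed (use e in \<open>auto simp: m_assoc\<close>)
  have ring: "ring (corner A e)"
    by (rule ringI[OF ab mon]) (auto simp: l_distr r_distr)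
  interpret C: ring "corner A e" by (rule ring)
  \<comment> \<open>Negatives are defined through the carrier, so those of the corner must first be
    identified with those of A.\<close>
  have diff: "x \<ominus>\<^bsub>corner A e\<^esub> y = x \<ominus> y"
    if "x \<in> carrier (corner A e)" "y \<in> carrier (corner A e)" for x y
  proof -
    have "\<ominus> y \<in> carrier (corner A e)" using that e by (auto simp: l_minus r_minus)
    then have "\<ominus>\<^bsub>corner A e\<^esub> y = \<ominus> y"
      using that by (intro C.minus_equality) (auto simp: l_neg)
    then show ?thesis by (simp add: a_minus_def)
  qed
  have module: "Module.module scalar_ring (corner A e)"
    by (rule moduleI[OF cring_scalar_ring ab])
      (use e in \<open>auto simp: scalar_ring_def smult_laws smult_mult_left smult_mult_right\<close>)
  show ?thesis
  proof (intro unital_banach_algebra.intro ring module unital_banach_algebra_axioms.intro)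
    fix X :: "nat \<Rightarrow> 'a"
    assume X: "\<And>n. X n \<in> carrier (corner A e)"
      and C: "\<forall>\<epsilon>>0. \<exists>M. \<forall>m\<ge>M. \<forall>n\<ge>M. nrm (corner A e) (X m \<ominus>\<^bsub>corner A e\<^esub> X n) < \<epsilon>"
    have XA: "X n \<in> carrier A" "e \<otimes> X n = X n" "X n \<otimes> e = X n" for n using X[of n] by auto
    obtain x where x: "x \<in> carrier A" "(\<lambda>n. nrm A (X n \<ominus> x)) \<longlonglongrightarrow> 0"
      using nrm_complete[of X] C XA(1) diff[OF X X] by auto
    have fixed: "f x = x"
      if f: "\<And>y. y \<in> carrier A \<Longrightarrow> f y \<in> carrier A" "\<And>n. f (X n) = X n"
        "\<And>y z. y \<in> carrier A \<Longrightarrow> z \<in> carrier A \<Longrightarrow> f (y \<ominus> z) = f y \<ominus> f z"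
        "\<And>y. y \<in> carrier A \<Longrightarrow> nrm A (f y) \<le> nrm A e * nrm A y" for f
    proof -
      have "nrm A (x \<ominus> f x) \<le> nrm A e * nrm A (X n \<ominus> x) + nrm A (X n \<ominus> x)" for n
      proof -
        \<comment> \<open>Since f fixes \<open>X n\<close>, the defect of x is expressed by X n - x
          alone.\<close>
        have "x \<ominus> f x = f (X n \<ominus> x) \<ominus> (X n \<ominus> x)"
          using XA(1) f x(1) by (simp add: a_minus_def minus_add a_ac r_neg1 r_neg2 minus_minus)
        also have "nrm A \<dots> \<le> nrm A (f (X n \<ominus> x)) + nrm A (X n \<ominus> x)"
          using XA(1) f x(1) by (intro nrm_minus_le) auto
        also have "\<dots> \<le> nrm A e * nrm A (X n \<ominus> x) + nrm A (X n \<ominus> x)"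
          using XA(1) f(4) x(1) by simp
        finally show ?thesis .
      qed
      moreover have "(\<lambda>n. nrm A e * nrm A (X n \<ominus> x) + nrm A (X n \<ominus> x)) \<longlonglongrightarrow> nrm A e * 0 + 0"
        by (intro tendsto_intros x)
      ultimately have "nrm A (x \<ominus> f x) \<le> 0"
        by (intro LIMSEQ_le_const[where X = "\<lambda>n. nrm A e * nrm A (X n \<ominus> x) + nrm A (X n \<ominus> x)"]) auto
      then have "x \<ominus> f x = \<zero>"
        using nrm_eq_0_iff[of "x \<ominus> f x"] nrm_nonneg[of "x \<ominus> f x"] x f by auto
      moreover have "x \<ominus> f x \<oplus> f x = x"
        using x(1) f(1) by (simp add: a_minus_def a_assoc l_neg)
      ultimately show ?thesis using x(1) f(1) by simp
    qed
    have "e \<otimes> x = x"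
      by (rule fixed) (use e XA in \<open>auto simp: a_minus_def r_distr r_minus nrm_mult_le\<close>)
    moreover have "x \<otimes> e = x"
      using nrm_mult_le e by (intro fixed) (use XA in \<open>auto simp: a_minus_def l_distr l_minus mult.commute\<close>)
    ultimately have "x \<in> carrier (corner A e)" using x by simp
    then show "\<exists>x\<in>carrier (corner A e). (\<lambda>n. nrm (corner A e) (X n \<ominus>\<^bsub>corner A e\<^esub> x)) \<longlonglongrightarrow> 0"
      using x diff[OF X] by auto
  qed (auto simp: smult_mult_left smult_mult_right nrm_nonneg nrm_triangle nrm_smult nrm_mult_le
      nrm_eq_0_iff)
qed

lemma compress_corner:
  assumes "e \<in> carrier A" "e \<otimes> e = e" "x \<in> carrier A"
  shows "e \<otimes> x \<otimes> e \<in> carrier (corner A e)"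
  using assms by (simp add: m_assoc) (metis m_assoc m_closed)

text \<open>The compression of x to e x e is linear and is the identity on the corner, so it carries
  a finite spanning set to a spanning set.\<close>

lemma corner_finite_dimensional:
  assumes e: "e \<in> carrier A" "e \<otimes> e = e" and fin: "finite_dimensional A"
  shows "finite_dimensional (corner A e)"
proof -
  interpret C: unital_banach_algebra "corner A e" by (rule corner_banach_algebra[OF e])
  obtain S where S: "finite S" "S \<subseteq> carrier A" "carrier A \<subseteq> lin_span S"
    using fin unfolding finite_dimensional_iff by blast
  define T where "T = (\<lambda>x. e \<otimes> x \<otimes> e)"
  have T: "T x \<in> carrier (corner A e)" if "x \<in> carrier A" for x
    unfolding T_def by (rule compress_corner[OF e that])
  have "T x \<in> C.lin_span (T ` S)" if "x \<in> carrier A" for x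
  proof (rule linear_image_lin_span[OF unital_banach_algebra_axioms C.unital_banach_algebra_axioms T])
    show "x \<in> lin_span S" using that S by blast
    show "T ` S \<subseteq> carrier (corner A e)" using T S(2) by blast
  qed (use e S smult_carrier in
      \<open>auto simp: T_def r_distr l_distr smult_mult_left smult_mult_right\<close>)
  moreover have "T x = x" if "x \<in> carrier (corner A e)" for x
    using that by (auto simp: T_def)
  ultimately have "carrier (corner A e) \<subseteq> C.lin_span (T ` S)" by fastforce
  moreover have "T ` S \<subseteq> carrier (corner A e)" using T S(2) by blast
  ultimately show ?thesis unfolding C.finite_dimensional_iff using S(1) by blast
qed

text \<open>Nonzero orthogonal idempotents are linearly independent. Their number is bounded by
  passing to coefficient vectors in a function space, where the dimension theory of
  \<open>vector_space\<close> applies.\<close>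

lemma finite_nonzero_orthogonal_idempotents:
  fixes E :: "'i \<Rightarrow> 'a"
  assumes fin: "finite_dimensional A"
    and E: "\<And>n. E n \<in> carrier A" "\<And>n. E n \<otimes> E n = E n"
    and orth: "\<And>m n. m \<noteq> n \<Longrightarrow> E m \<otimes> E n = \<zero>"
  shows "finite {n. E n \<noteq> \<zero>}"
proof -
  note [simp] = smult_carrier
  obtain S where S: "finite S" "S \<subseteq> carrier A" "\<forall>x\<in>carrier A. \<exists>c. x = (\<Oplus>s\<in>S. c s \<odot> s)"
    using fin unfolding finite_dimensional_def by blast
  then obtain c where c: "\<And>x. x \<in> carrier A \<Longrightarrow> x = (\<Oplus>s\<in>S. c x s \<odot> s)"
    by metis
  \<comment> \<open>The chosen coefficients \<open>c\<close> need not depend linearly on the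
    element: the argument only passes from a relation between coefficient vectors to one between
    idempotents, never back.\<close>
  define V :: "'i \<Rightarrow> 'a \<Rightarrow> 'k" where "V = (\<lambda>n s. if s \<in> S then c (E n) s else 0)"
  interpret F: vector_space "\<lambda>(t::'k) (f::'a \<Rightarrow> 'k) x. t * f x"
    by unfold_locales (auto simp: fun_eq_iff algebra_simps)
  let ?I = "{n. E n \<noteq> \<zero>}"
  have comb: "(\<Oplus>n\<in>J. w n \<odot> E n) = (\<Oplus>s\<in>S. (\<Sum>n\<in>J. w n * c (E n) s) \<odot> s)" if "finite J" for J w
    using that
  proof (induction J rule: finite_induct)
    case empty
    have "(\<Oplus>s\<in>S. 0 \<odot> s) = (\<Oplus>s\<in>S. \<zero>)"
      by (rule finsum_cong') (use S smult_zero_left in auto)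
    then show ?case by simp
  next
    case (insert m J)
    have "w m \<odot> E m = w m \<odot> (\<Oplus>s\<in>S. c (E m) s \<odot> s)"
      using c[OF E(1)] by simp
    also have "\<dots> = (\<Oplus>s\<in>S. w m \<odot> (c (E m) s \<odot> s))"
      using S by (intro scalars.finsum_smult_ldistr) (auto simp: scalar_ring_def)
    also have "\<dots> = (\<Oplus>s\<in>S. (w m * c (E m) s) \<odot> s)"
      using S smult_laws(3) by (intro finsum_cong') auto
    finally have m: "w m \<odot> E m = (\<Oplus>s\<in>S. (w m * c (E m) s) \<odot> s)" .
    have "(\<Oplus>n\<in>insert m J. w n \<odot> E n) = w m \<odot> E m \<oplus> (\<Oplus>n\<in>J. w n \<odot> E n)"
      using insert.hyps E(1) by (intro finsum_insert) auto
    also have "\<dots> = (\<Oplus>s\<in>S. (w m * c (E m) s) \<odot> s \<oplus> (\<Sum>n\<in>J. w n * c (E n) s) \<odot> s)"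
      unfolding m insert.IH using S by (subst finsum_addf) auto
    also have "\<dots> = (\<Oplus>s\<in>S. (\<Sum>n\<in>insert m J. w n * c (E n) s) \<odot> s)"
      using S insert.hyps smult_laws(1) by (intro finsum_cong') auto
    finally show ?case .
  qed
  have indep: "w m = 0"
    if J: "finite J" "J \<subseteq> ?I" "m \<in> J" and 0: "\<And>s. s \<in> S \<Longrightarrow> (\<Sum>n\<in>J. w n * c (E n) s) = 0" for J m w
  proof -
    have "(\<Oplus>s\<in>S. (\<Sum>n\<in>J. w n * c (E n) s) \<odot> s) = (\<Oplus>s\<in>S. \<zero>)"
      by (rule finsum_cong') (use S smult_zero_left 0 in auto)
    then have "(\<Oplus>n\<in>J. w n \<odot> E n) = \<zero>" using comb[OF J(1)] by simp
    \<comment> \<open>Multiplication by \<open>E m\<close> isolates the term of index m.\<close>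
    then have "\<zero> = E m \<otimes> (\<Oplus>n\<in>J. w n \<odot> E n)" using E(1) by simp
    also have "\<dots> = (\<Oplus>n\<in>J. E m \<otimes> (w n \<odot> E n))"
      using J(1) E(1) by (intro finsum_rdistr) auto
    also have "\<dots> = (\<Oplus>n\<in>J. if m = n then w n \<odot> E n else \<zero>)"
      using E orth by (intro finsum_cong') (auto simp: smult_mult_right)
    also have "\<dots> = w m \<odot> E m"
      using J E(1) by (intro add.finprod_singleton) auto
    finally have "norm (w m) * nrm A (E m) = 0" using E(1) by (metis nrm_smult nrm_zero)
    then show "w m = 0" using J E(1) nrm_eq_0_iff by auto
  qed
  \<comment> \<open>The claim counts indices, not elements: if E m = E n with m \<noteq> n, then E m
    = E m E n = 0.\<close>
  have inj: "inj_on V ?I"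
  proof (rule inj_onI)
    fix m n assume mn: "m \<in> ?I" "n \<in> ?I" "V m = V n"
    have "c (E m) s = c (E n) s" if "s \<in> S" for s
      using fun_cong[OF mn(3), of s] that by (simp add: V_def)
    then have "(\<Oplus>s\<in>S. c (E m) s \<odot> s) = (\<Oplus>s\<in>S. c (E n) s \<odot> s)"
      using S by (intro finsum_cong') auto
    then have "E m = E n" using c E(1) by metis
    then show "m = n" using mn orth[of m n] E(2)[of m] by auto
  qed
  have "F.independent (V ` ?I)"
    unfolding F.independent_explicit_finite_subsets
  proof (intro allI impI ballI)
    fix T w v assume T: "T \<subseteq> V ` ?I" "finite T" "(\<Sum>v\<in>T. (\<lambda>x. w v * v x)) = 0" "v \<in> T"
    obtain J where J: "J \<subseteq> ?I" "finite J" "T = V ` J"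
      using finite_subset_image[OF T(2,1)] by blast
    then have injJ: "inj_on V J" using inj inj_on_subset by blast
    obtain m where m: "m \<in> J" "v = V m" using T(4) J by blast
    have sum_app: "(\<Sum>v\<in>U. g v) x = (\<Sum>v\<in>U. g v x)" if "finite U"
      for U and g :: "('a \<Rightarrow> 'k) \<Rightarrow> 'a \<Rightarrow> 'k" and x
      using that by (induction U rule: finite_induct) auto
    have "(\<Sum>n\<in>J. w (V n) * c (E n) s) = 0" if "s \<in> S" for s
    proof -
      have "0 = (\<Sum>v\<in>T. w v * v s)"
        using fun_cong[OF T(3), of s] sum_app[OF T(2)] by simp
      also have "\<dots> = (\<Sum>n\<in>J. w (V n) * V n s)"
        unfolding J(3) by (simp add: sum.reindex[OF injJ])
      finally show ?thesis using that by (simp add: V_def)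
    qed
    from indep[OF J(2,1) m(1) this] show "w v = 0" using m by simp
  qed
  \<comment> \<open>All these vectors vanish off S, so they lie in the span of the indicator
    functions of the points of S.\<close>
  moreover have "V ` ?I \<subseteq> F.span ((\<lambda>s x. if x = s then 1 else 0) ` S)"
  proof
    fix f assume "f \<in> V ` ?I"
    then have f: "f s = 0" if "s \<notin> S" for s using that by (auto simp: V_def)
    have "f = (\<Sum>s\<in>S. (\<lambda>x. f s * (if x = s then 1 else 0)))"
    proof
      fix x
      have "(\<Sum>s\<in>U. (\<lambda>x. f s * (if x = s then 1 else 0))) x = (if x \<in> U then f x else 0)"
        if "finite U" for U
        using that by (induction U rule: finite_induct) auto
      then show "f x = (\<Sum>s\<in>S. (\<lambda>x. f s * (if x = s then 1 else 0))) x"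
        using S(1) f by simp
    qed
    also have "\<dots> \<in> F.span ((\<lambda>s x. if x = s then 1 else 0) ` S)"
      by (intro F.span_sum F.span_scale F.span_base imageI)
    finally show "f \<in> F.span ((\<lambda>s x. if x = s then 1 else 0) ` S)" .
  qed
  ultimately have "finite (V ` ?I)"
    using F.independent_span_bound S(1) by blast
  then show ?thesis using inj finite_imageD by blast
qed

end

section \<open>Bounded inverse limits\<close>

lemma Inf_eq_iff_approx:
  fixes x :: real
  assumes "\<And>y. y \<in> Y \<Longrightarrow> x \<le> y" "\<And>\<epsilon>. \<epsilon> > 0 \<Longrightarrow> \<exists>y\<in>Y. y < x + \<epsilon>"
  shows "x = Inf Y"
proof (rule antisym)
  have "Y \<noteq> {}" using assms(2)[of 1] by auto
  then show "x \<le> Inf Y" using assms(1) by (rule cInf_greatest)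
  have bdd: "bdd_below Y" using assms(1) by (auto simp: bdd_below_def)
  show "Inf Y \<le> x"
  proof (rule field_le_epsilon)
    fix \<epsilon> :: real assume "0 < \<epsilon>"
    then obtain y where "y \<in> Y" "y < x + \<epsilon>" using assms(2) by blast
    then show "Inf Y \<le> x + \<epsilon>" using cInf_lower[OF _ bdd, of y] by linarith
  qed
qed

text \<open>The quotient norm condition is split into its lower bound, contractivity, and lifts with
  an error \<epsilon>, which also yield surjectivity.\<close>

lemma admissible_systemI:
  fixes S :: "nat \<Rightarrow> ('k::real_or_complex, 'a) normed_algebra"
  assumes alg: "\<And>r. unital_banach_algebra (S r)" "\<And>r. finite_dimensional (S r)"
      "\<And>r. nrm (S r) \<one>\<^bsub>S r\<^esub> = 1"
    and hom: "\<And>r s. r \<le> s \<Longrightarrow> p r s \<in> unital_algebra_hom (S s) (S r)"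
    and refl: "\<And>r x. x \<in> carrier (S r) \<Longrightarrow> p r r x = x"
    and comp: "\<And>r s t x. r \<le> s \<Longrightarrow> s \<le> t \<Longrightarrow> x \<in> carrier (S t) \<Longrightarrow> p r s (p s t x) = p r t x"
    and contr: "\<And>r s x. r \<le> s \<Longrightarrow> x \<in> carrier (S s) \<Longrightarrow> nrm (S r) (p r s x) \<le> nrm (S s) x"
    and lift: "\<And>r s x \<epsilon>. r \<le> s \<Longrightarrow> x \<in> carrier (S r) \<Longrightarrow> \<epsilon> > 0 \<Longrightarrow>
      \<exists>y\<in>carrier (S s). p r s y = x \<and> nrm (S s) y < nrm (S r) x + \<epsilon>"
  shows "admissible_system S p"
  unfolding admissible_system_def
proof (intro conjI allI impI ballI)
  fix r s x assume rs: "r \<le> s" and x: "x \<in> carrier (S r)"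
  show "\<exists>y\<in>carrier (S s). p r s y = x" using lift[OF rs x, of 1] by auto
  show "nrm (S r) x = Inf {nrm (S s) y |y. y \<in> carrier (S s) \<and> p r s y = x}"
    by (rule Inf_eq_iff_approx) (use contr[OF rs] lift[OF rs x] in blast)+
qed (use alg hom refl comp in auto)

section \<open>Calculus in an admissible system\<close>

locale admissible =
  fixes S :: "nat \<Rightarrow> ('k::real_or_complex, 'a) normed_algebra" and p
  assumes admissible_system: "admissible_system S p"
begin

lemma banach_algebra: "unital_banach_algebra (S r)"
  and finite_dim: "finite_dimensional (S r)"
  using admissible_system by (auto simp: admissible_system_def)

sublocale S: unital_banach_algebra "S r" for r
  by (rule banach_algebra)

lemma bonding_hom: "r \<le> s \<Longrightarrow> p r s \<in> unital_algebra_hom (S s) (S r)"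
  using admissible_system by (auto simp: admissible_system_def)

lemma bonding_simps [simp]:
  assumes "r \<le> s"
  shows "x \<in> carrier (S s) \<Longrightarrow> p r s x \<in> carrier (S r)"
    and "x \<in> carrier (S s) \<Longrightarrow> y \<in> carrier (S s) \<Longrightarrow>
      p r s (x \<otimes>\<^bsub>S s\<^esub> y) = p r s x \<otimes>\<^bsub>S r\<^esub> p r s y"
    and "x \<in> carrier (S s) \<Longrightarrow> y \<in> carrier (S s) \<Longrightarrow>
      p r s (x \<oplus>\<^bsub>S s\<^esub> y) = p r s x \<oplus>\<^bsub>S r\<^esub> p r s y"
    and "x \<in> carrier (S s) \<Longrightarrow> p r s (c \<odot>\<^bsub>S s\<^esub> x) = c \<odot>\<^bsub>S r\<^esub> p r s x"
    and "p r s \<one>\<^bsub>S s\<^esub> = \<one>\<^bsub>S r\<^esub>"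
  using bonding_hom[OF assms] by (auto simp: unital_algebra_hom_def ring_hom_def)

lemma bonding_zero [simp]: "r \<le> s \<Longrightarrow> p r s \<zero>\<^bsub>S s\<^esub> = \<zero>\<^bsub>S r\<^esub>"
  using bonding_simps(4)[of r s "\<zero>\<^bsub>S s\<^esub>" 0] by (simp add: S.smult_zero_left)

lemma bonding_refl [simp]: "x \<in> carrier (S r) \<Longrightarrow> p r r x = x"
  and bonding_comp: "r \<le> s \<Longrightarrow> s \<le> t \<Longrightarrow> x \<in> carrier (S t) \<Longrightarrow> p r s (p s t x) = p r t x"
  using admissible_system by (auto simp: admissible_system_def)

lemma
  assumes rs: "r \<le> s" and x: "x \<in> carrier (S r)"
  shows ex_lift: "\<epsilon> > 0 \<Longrightarrow> \<exists>y\<in>carrier (S s). p r s y = x \<and> nrm (S s) y < nrm (S r) x + \<epsilon>"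
    and nrm_le_lift: "y \<in> carrier (S s) \<Longrightarrow> p r s y = x \<Longrightarrow> nrm (S r) x \<le> nrm (S s) y"
proof -
  let ?L = "{nrm (S s) y |y. y \<in> carrier (S s) \<and> p r s y = x}"
  have "\<forall>r s. r \<le> s \<longrightarrow> (\<forall>x\<in>carrier (S r). (\<exists>y\<in>carrier (S s). p r s y = x) \<and>
      nrm (S r) x = Inf {nrm (S s) y |y. y \<in> carrier (S s) \<and> p r s y = x})"
    using admissible_system unfolding admissible_system_def by (elim conjE)
  then have "\<exists>y\<in>carrier (S s). p r s y = x" and Inf: "nrm (S r) x = Inf ?L"
    using rs x by auto
  then have ne: "?L \<noteq> {}" by blast
  have bdd: "bdd_below ?L" using S.nrm_nonneg by (auto simp: bdd_below_def)
  show "\<exists>y\<in>carrier (S s). p r s y = x \<and> nrm (S s) y < nrm (S r) x + \<epsilon>" if "\<epsilon> > 0"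
    using cInf_lessD[OF ne, of "nrm (S r) x + \<epsilon>"] Inf that by auto
  show "nrm (S r) x \<le> nrm (S s) y" if "y \<in> carrier (S s)" "p r s y = x"
    unfolding Inf by (rule cInf_lower[OF _ bdd]) (use that in blast)
qed

lemma bonding_contractive: "r \<le> s \<Longrightarrow> x \<in> carrier (S s) \<Longrightarrow> nrm (S r) (p r s x) \<le> nrm (S s) x"
  using nrm_le_lift[of r s "p r s x" x] by simp

text \<open>The boundedness of limit elements is left out, so that an explicit bound C can be
  carried separately.\<close>

definition coherent :: "(nat \<Rightarrow> 'a) \<Rightarrow> bool" where
  "coherent y \<longleftrightarrow> (\<forall>r. y r \<in> carrier (S r)) \<and> (\<forall>r s. r \<le> s \<longrightarrow> p r s (y s) = y r)"

lemma coherentD: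
  assumes "coherent y"
  shows "y r \<in> carrier (S r)" "r \<le> s \<Longrightarrow> p r s (y s) = y r"
  using assms by (auto simp: coherent_def)

text \<open>This makes the supremum in the limit norm an ordinary limit, so index shifts and
  continuity arguments apply to it.\<close>

lemma coherent_incseq:
  assumes "coherent y"
  shows "incseq (\<lambda>r. nrm (S r) (y r))"
  unfolding incseq_def
proof (intro allI impI)
  fix r s :: nat assume "r \<le> s"
  then show "nrm (S r) (y r) \<le> nrm (S s) (y s)"
    using bonding_contractive[of r s "y s"] coherentD[OF assms] by simp
qed

text \<open>Convergence of the coordinate norms gives both boundedness of the image and isometry,
  because these norms increase.\<close>

lemma isometrically_isomorphic_limitI:
  assumes coherent: "\<And>a. a \<in> carrier A \<Longrightarrow> coherent (h a)"
    and mult: "\<And>a b r. a \<in> carrier A \<Longrightarrow> b \<in> carrier A \<Longrightarrow> h (a \<otimes>\<^bsub>A\<^esub> b) r = h a r \<otimes>\<^bsub>S r\<^esub> h b r"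
    and add: "\<And>a b r. a \<in> carrier A \<Longrightarrow> b \<in> carrier A \<Longrightarrow> h (a \<oplus>\<^bsub>A\<^esub> b) r = h a r \<oplus>\<^bsub>S r\<^esub> h b r"
    and smult: "\<And>a c r. a \<in> carrier A \<Longrightarrow> h (c \<odot>\<^bsub>A\<^esub> a) r = c \<odot>\<^bsub>S r\<^esub> h a r"
    and one: "\<And>r. h \<one>\<^bsub>A\<^esub> r = \<one>\<^bsub>S r\<^esub>"
    and inj: "\<And>a b. a \<in> carrier A \<Longrightarrow> b \<in> carrier A \<Longrightarrow> h a = h b \<Longrightarrow> a = b"
    and surj: "\<And>y C. coherent y \<Longrightarrow> (\<And>r. nrm (S r) (y r) \<le> C) \<Longrightarrow> \<exists>a\<in>carrier A. h a = y"
    and lim: "\<And>a. a \<in> carrier A \<Longrightarrow> (\<lambda>r. nrm (S r) (h a r)) \<longlonglongrightarrow> nrm A a"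
  shows "isometrically_isomorphic A (bounded_inverse_limit S p)"
proof -
  let ?L = "bounded_inverse_limit S p"
  have bdd: "bdd_above (range (\<lambda>r. nrm (S r) (h a r)))" if "a \<in> carrier A" for a
    using incseq_le[OF coherent_incseq[OF coherent[OF that]] lim[OF that]]
    by (intro bdd_aboveI[of _ "nrm A a"]) auto
  have c: "h a \<in> carrier ?L" if "a \<in> carrier A" for a
    using bdd[OF that] coherent[OF that] by (auto simp: bounded_inverse_limit_def coherent_def)
  have "h \<in> unital_algebra_hom A ?L"
    unfolding unital_algebra_hom_def using c
    by (auto intro!: ring_hom_memI simp: bounded_inverse_limit_def fun_eq_iff mult add smult one)
  moreover have "bij_betw h (carrier A) (carrier ?L)"
  proof (rule bij_betwI')
    fix y assume "y \<in> carrier ?L"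
    then have y: "coherent y" "bdd_above (range (\<lambda>r. nrm (S r) (y r)))"
      by (auto simp: bounded_inverse_limit_def coherent_def)
    then obtain C where "\<And>r. nrm (S r) (y r) \<le> C" by (auto simp: bdd_above_def)
    then show "\<exists>a\<in>carrier A. y = h a" using surj[OF y(1)] by metis
  qed (use c inj in auto)
  moreover have "nrm ?L (h a) = nrm A a" if "a \<in> carrier A" for a
  proof -
    have "(\<lambda>r. nrm (S r) (h a r)) \<longlonglongrightarrow> (SUP r. nrm (S r) (h a r))"
      by (rule LIMSEQ_incseq_SUP[OF bdd[OF that] coherent_incseq[OF coherent[OF that]]])
    then show ?thesis
      using LIMSEQ_unique[OF _ lim[OF that]] by (simp add: bounded_inverse_limit_def)
  qed
  ultimately show ?thesis unfolding isometrically_isomorphic_def by blast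
qed

end

text \<open>A is an arbitrary record here; its operations are controlled only through the
  coordinates \<open>h x r\<close>, and equalities in A are checked there.\<close>

locale limit_representation = admissible S p
  for S :: "nat \<Rightarrow> ('k::real_or_complex, 'c) normed_algebra" and p +
  fixes A :: "('k, 'a, 'm) normed_algebra_scheme" and h
  assumes h_hom: "h \<in> unital_algebra_hom A (bounded_inverse_limit S p)"
    and h_bij: "bij_betw h (carrier A) (carrier (bounded_inverse_limit S p))"
    and h_isom: "x \<in> carrier A \<Longrightarrow> nrm (bounded_inverse_limit S p) (h x) = nrm A x"
begin

lemma h_limit: "x \<in> carrier A \<Longrightarrow> h x \<in> carrier (bounded_inverse_limit S p)"
  using h_bij by (auto simp: bij_betw_def)

lemma h_coherent: "x \<in> carrier A \<Longrightarrow> coherent (h x)"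
  using h_limit[of x] by (auto simp: bounded_inverse_limit_def coherent_def)

lemma h_simps:
  "x \<in> carrier A \<Longrightarrow> h x r \<in> carrier (S r)"
  "x \<in> carrier A \<Longrightarrow> r \<le> s \<Longrightarrow> p r s (h x s) = h x r"
  "x \<in> carrier A \<Longrightarrow> y \<in> carrier A \<Longrightarrow> h (x \<otimes>\<^bsub>A\<^esub> y) r = h x r \<otimes>\<^bsub>S r\<^esub> h y r"
  "x \<in> carrier A \<Longrightarrow> y \<in> carrier A \<Longrightarrow> h (x \<oplus>\<^bsub>A\<^esub> y) r = h x r \<oplus>\<^bsub>S r\<^esub> h y r"
  "x \<in> carrier A \<Longrightarrow> h (c \<odot>\<^bsub>A\<^esub> x) r = c \<odot>\<^bsub>S r\<^esub> h x r"
  "h \<one>\<^bsub>A\<^esub> r = \<one>\<^bsub>S r\<^esub>"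
  using h_hom h_coherent[of x]
  by (auto simp: coherent_def unital_algebra_hom_def ring_hom_def bounded_inverse_limit_def)

lemma h_inj:
  assumes "x \<in> carrier A" "y \<in> carrier A" "\<And>r. h x r = h y r"
  shows "x = y"
proof -
  have "h x = h y" using assms(3) by auto
  then show ?thesis using h_bij assms(1,2) by (auto simp: bij_betw_def inj_on_def)
qed

lemma h_lim:
  assumes "x \<in> carrier A"
  shows "(\<lambda>r. nrm (S r) (h x r)) \<longlonglongrightarrow> nrm A x"
proof -
  have "bdd_above (range (\<lambda>r. nrm (S r) (h x r)))"
    using h_limit[OF assms] by (auto simp: bounded_inverse_limit_def)
  then show ?thesis
    using LIMSEQ_incseq_SUP[OF _ coherent_incseq[OF h_coherent[OF assms]]] h_isom[OF assms]
    by (simp add: bounded_inverse_limit_def)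
qed

lemma h_le: "x \<in> carrier A \<Longrightarrow> nrm (S r) (h x r) \<le> nrm A x"
  using incseq_le[OF coherent_incseq[OF h_coherent] h_lim] by blast

text \<open>The bound on the coordinates passes to the preimage; this is the compactness-like
  substitute used to bound coordinatewise limits.\<close>

lemma h_surj:
  assumes "coherent y" "\<And>r. nrm (S r) (y r) \<le> C"
  obtains x where "x \<in> carrier A" "h x = y" "nrm A x \<le> C"
proof -
  have "y \<in> carrier (bounded_inverse_limit S p)"
    using assms by (auto simp: bounded_inverse_limit_def coherent_def bdd_above_def)
  then have "y \<in> h ` carrier A" using h_bij by (simp add: bij_betw_def)
  then obtain x where x: "x \<in> carrier A" "h x = y" by blast
  then have "nrm A x \<le> C" using LIMSEQ_le_const2[OF h_lim] assms(2) by blast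
  then show thesis using that x by blast
qed

end

section \<open>Limits up to isomorphism, and their corners\<close>

lemma is_bounded_inverse_limitE:
  fixes A :: "('k::real_or_complex, 'a, 'm) normed_algebra_scheme"
  assumes "is_bounded_inverse_limit A"
  obtains S :: "nat \<Rightarrow> ('k, nat \<Rightarrow> 'k) normed_algebra" and p h
  where "limit_representation S p A h"
proof -
  obtain S :: "nat \<Rightarrow> ('k, nat \<Rightarrow> 'k) normed_algebra" and p where
    adm: "admissible_system S p" and iso: "isometrically_isomorphic A (bounded_inverse_limit S p)"
    using assms unfolding is_bounded_inverse_limit_def by blast
  obtain h where "h \<in> unital_algebra_hom A (bounded_inverse_limit S p)"
    "bij_betw h (carrier A) (carrier (bounded_inverse_limit S p))"
    "\<forall>x\<in>carrier A. nrm (bounded_inverse_limit S p) (h x) = nrm A x"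
    using iso unfolding isometrically_isomorphic_def by blast
  with adm have "limit_representation S p A h" by unfold_locales auto
  then show thesis by (rule that)
qed

lemma is_bounded_inverse_limit_isomorphic:
  fixes A :: "('k::real_or_complex, 'a, 'm) normed_algebra_scheme"
    and B :: "('k, 'b, 'n) normed_algebra_scheme"
  assumes "isometrically_isomorphic B A" "is_bounded_inverse_limit A"
  shows "is_bounded_inverse_limit B"
proof -
  obtain S :: "nat \<Rightarrow> ('k, nat \<Rightarrow> 'k) normed_algebra" and p h
    where "limit_representation S p A h"
    using is_bounded_inverse_limitE[OF assms(2)] .
  then interpret limit_representation S p A h .
  obtain g where g: "g \<in> unital_algebra_hom B A" "bij_betw g (carrier B) (carrier A)"
    "\<forall>x\<in>carrier B. nrm A (g x) = nrm B x"
    using assms(1) unfolding isometrically_isomorphic_def by blast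
  have gc: "g x \<in> carrier A" if "x \<in> carrier B" for x
    using g(2) that by (auto simp: bij_betw_def)
  have "h \<circ> g \<in> unital_algebra_hom B (bounded_inverse_limit S p)"
    using h_hom g(1) gc ring_hom_trans[of g B A h "bounded_inverse_limit S p"]
    by (auto simp: unital_algebra_hom_def)
  moreover have "bij_betw (h \<circ> g) (carrier B) (carrier (bounded_inverse_limit S p))"
    using g(2) h_bij by (rule bij_betw_trans)
  moreover have "\<forall>x\<in>carrier B. nrm (bounded_inverse_limit S p) ((h \<circ> g) x) = nrm B x"
    using g(3) gc h_isom by simp
  ultimately have "isometrically_isomorphic B (bounded_inverse_limit S p)"
    unfolding isometrically_isomorphic_def by blast
  then show ?thesis by (rule is_bounded_inverse_limitI[OF admissible_system])
qed

text \<open>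
  Some coordinates of \<open>e\<close> may vanish, but only finitely many. The system of the corners is started
  after these, since the corner at a zero coordinate has \<open>\<one> = \<zero>\<close> of norm 0.
\<close>

lemma corner_is_bounded_inverse_limit:
  fixes A :: "('k::real_or_complex, 'a, 'm) normed_algebra_scheme"
  assumes A: "is_bounded_inverse_limit A"
    and closed: "\<And>x y. x \<in> carrier A \<Longrightarrow> y \<in> carrier A \<Longrightarrow> x \<otimes>\<^bsub>A\<^esub> y \<in> carrier A"
    and e: "e \<in> carrier A" "e \<otimes>\<^bsub>A\<^esub> e = e" "nrm A e = 1"
  shows "is_bounded_inverse_limit (corner A e)"
proof -
  obtain S :: "nat \<Rightarrow> ('k, nat \<Rightarrow> 'k) normed_algebra" and p h
    where "limit_representation S p A h"
    using is_bounded_inverse_limitE[OF A] .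
  then interpret limit_representation S p A h .
  define f where "f = h e"
  have f: "f r \<in> carrier (S r)" "f r \<otimes>\<^bsub>S r\<^esub> f r = f r" "nrm (S r) (f r) \<le> 1" for r
    using h_simps(1)[OF e(1), of r] h_simps(3)[OF e(1) e(1), of r] h_le[OF e(1), of r] e
    by (simp_all add: f_def)
  have pf: "p r s (f s) = f r" if "r \<le> s" for r s
    using h_simps(2)[OF e(1) that] by (simp add: f_def)
  have "\<exists>k. f k \<noteq> \<zero>\<^bsub>S k\<^esub>"
  proof (rule ccontr)
    assume "\<nexists>k. f k \<noteq> \<zero>\<^bsub>S k\<^esub>"
    then have "(\<lambda>r. nrm (S r) (h e r)) = (\<lambda>r. 0)" by (auto simp: f_def)
    then show False using h_lim[OF e(1)] e(3) by (simp add: LIMSEQ_const_iff)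
  qed
  then obtain k where k: "f k \<noteq> \<zero>\<^bsub>S k\<^esub>" by blast
  \<comment> \<open>A zero at a later level would be mapped to a zero at level k.\<close>
  have f_ne: "f (k + r) \<noteq> \<zero>\<^bsub>S (k + r)\<^esub>" for r
    using k pf[of k "k + r"] by auto
  have f_nrm: "nrm (S (k + r)) (f (k + r)) = 1" for r
  proof -
    let ?t = "nrm (S (k + r)) (f (k + r))"
    \<comment> \<open>Idempotence and submultiplicativity give t \<le> t^2, hence t \<ge> 1 for a
      nonzero idempotent; contractivity of the coordinates gives t \<le> 1.\<close>
    have "?t \<le> ?t * ?t" using S.nrm_mult_le[OF f(1) f(1), of "k + r"] f(2) by simp
    moreover have "0 < ?t"
      using f_ne[of r] S.nrm_eq_0_iff[OF f(1), of "k + r"] S.nrm_nonneg[OF f(1), of "k + r"] by simp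
    ultimately have "1 \<le> ?t" by simp
    then show ?thesis using f(3)[of "k + r"] by simp
  qed
  define T where "T = (\<lambda>r. corner (S (k + r)) (f (k + r)))"
  define q where "q = (\<lambda>r s. p (k + r) (k + s))"
  have Tc: "x \<in> carrier (T r) \<longleftrightarrow> x \<in> carrier (S (k + r)) \<and>
      f (k + r) \<otimes>\<^bsub>S (k + r)\<^esub> x = x \<and> x \<otimes>\<^bsub>S (k + r)\<^esub> f (k + r) = x" for x r
    by (simp add: T_def)
  have q_carrier: "q r s x \<in> carrier (T r)" if "r \<le> s" "x \<in> carrier (T s)" for r s x
    using that f(1)[of "k + s"] pf[of "k + r" "k + s"]
      bonding_simps(2)[of "k + r" "k + s" "f (k + s)" x] bonding_simps(2)[of "k + r" "k + s" x "f (k + s)"]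
    unfolding Tc q_def by simp
  have adm: "admissible_system T q"
  proof (rule admissible_systemI)
    fix r s :: nat assume rs: "r \<le> s"
    show "q r s \<in> unital_algebra_hom (T s) (T r)"
      unfolding unital_algebra_hom_def using q_carrier[OF rs] rs pf
      by (auto intro!: ring_hom_memI simp: T_def q_def)
  next
    fix r s x and \<epsilon> :: real assume rs: "r \<le> s" and x: "x \<in> carrier (T r)" and "0 < \<epsilon>"
    then obtain y where y: "y \<in> carrier (S (k + s))" "q r s y = x"
      "nrm (S (k + s)) y < nrm (T r) x + \<epsilon>"
      using ex_lift[of "k + r" "k + s" x \<epsilon>] by (auto simp: q_def T_def)
    let ?f = "f (k + s)"
    \<comment> \<open>The lift y need not lie in the corner. Its compression does, has no larger
      norm, and still maps to x because x is fixed by \<open>f (k + r)\<close> on both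
      sides.\<close>
    let ?y = "?f \<otimes>\<^bsub>S (k + s)\<^esub> y \<otimes>\<^bsub>S (k + s)\<^esub> ?f"
    have "nrm (S (k + s)) ?y \<le> nrm (S (k + s)) (?f \<otimes>\<^bsub>S (k + s)\<^esub> y) * nrm (S (k + s)) ?f"
      using f y by (intro S.nrm_mult_le) auto
    also have "\<dots> \<le> nrm (S (k + s)) ?f * nrm (S (k + s)) y * nrm (S (k + s)) ?f"
      using f y by (intro mult_right_mono S.nrm_mult_le S.nrm_nonneg) auto
    also have "\<dots> = nrm (S (k + s)) y" by (simp add: f_nrm)
    finally have "nrm (T s) ?y < nrm (T r) x + \<epsilon>" using y(3) by (simp add: T_def)
    moreover have "q r s ?y = x"
      using f(1) y x rs pf by (simp add: q_def Tc)
    moreover have "?y \<in> carrier (T s)"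
      unfolding T_def by (rule S.compress_corner[OF f(1,2) y(1)])
    ultimately show "\<exists>y\<in>carrier (T s). q r s y = x \<and> nrm (T s) y < nrm (T r) x + \<epsilon>" by blast
  next
    fix r s x assume "r \<le> s" "x \<in> carrier (T s)"
    then show "nrm (T r) (q r s x) \<le> nrm (T s) x"
      using bonding_contractive[of "k + r" "k + s" x] by (simp add: T_def q_def)
  qed (use S.corner_banach_algebra[OF f(1,2)] S.corner_finite_dimensional[OF f(1,2) finite_dim]
      f_nrm bonding_comp in \<open>auto simp: T_def q_def\<close>)
  interpret T: admissible T q by unfold_locales (rule adm)
  have "isometrically_isomorphic (corner A e) (bounded_inverse_limit T q)"
  proof (rule T.isometrically_isomorphic_limitI[where h = "\<lambda>x r. h x (k + r)"])
    fix a assume "a \<in> carrier (corner A e)"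
    then have a: "a \<in> carrier A" "e \<otimes>\<^bsub>A\<^esub> a = a" "a \<otimes>\<^bsub>A\<^esub> e = a" by auto
    have "f r \<otimes>\<^bsub>S r\<^esub> h a r = h a r" "h a r \<otimes>\<^bsub>S r\<^esub> f r = h a r" for r
      using h_simps(3)[OF e(1) a(1), of r] h_simps(3)[OF a(1) e(1), of r] a(2,3)
      by (simp_all add: f_def)
    then show "T.coherent (\<lambda>r. h a (k + r))"
      unfolding T.coherent_def unfolding Tc q_def using h_simps(1,2)[OF a(1)] by simp
    show "(\<lambda>r. nrm (T r) (h a (k + r))) \<longlonglongrightarrow> nrm (corner A e) a"
      using LIMSEQ_ignore_initial_segment[OF h_lim[OF a(1)], of k] by (simp add: T_def add.commute)
  next
    fix a b assume ab: "a \<in> carrier (corner A e)" "b \<in> carrier (corner A e)"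
      "(\<lambda>r. h a (k + r)) = (\<lambda>r. h b (k + r))"
    have "h a r = h b r" for r
      using h_simps(2)[of a r "k + r"] h_simps(2)[of b r "k + r"] fun_cong[OF ab(3), of r] ab(1,2)
      by simp
    then show "a = b" using h_inj ab by simp
  next
    fix y C assume y: "T.coherent y" "\<And>r. nrm (T r) (y r) \<le> C"
    \<comment> \<open>Undoes the shift by k: coordinate r is obtained from level k + r, uniformly in
      r, which also supplies the first k coordinates.\<close>
    define z where "z = (\<lambda>r. p r (k + r) (y r))"
    have yS: "y r \<in> carrier (S (k + r))" "f (k + r) \<otimes>\<^bsub>S (k + r)\<^esub> y r = y r"
      "y r \<otimes>\<^bsub>S (k + r)\<^esub> f (k + r) = y r" for r
      using T.coherentD(1)[OF y(1), of r] by (auto simp: Tc)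
    have yq: "p (k + r) (k + s) (y s) = y r" if "r \<le> s" for r s
      using T.coherentD(2)[OF y(1) that] by (simp add: q_def)
    have "coherent z"
      unfolding coherent_def
    proof (intro conjI allI impI)
      fix r s :: nat assume rs: "r \<le> s"
      have "p r s (z s) = p r (k + r) (p (k + r) (k + s) (y s))"
        unfolding z_def using yS rs by (simp add: bonding_comp)
      then show "p r s (z s) = z r" using yq[OF rs] by (simp add: z_def)
    qed (use yS in \<open>simp add: z_def\<close>)
    moreover have "nrm (S r) (z r) \<le> C" for r
      using bonding_contractive[of r "k + r" "y r"] yS y(2)[of r] by (simp add: z_def T_def)
    ultimately obtain a where a: "a \<in> carrier A" "h a = z" by (rule h_surj)
    have fz: "f r \<otimes>\<^bsub>S r\<^esub> z r = z r" "z r \<otimes>\<^bsub>S r\<^esub> f r = z r" for r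
      using yS[of r] f(1)[of "k + r"] pf[of r "k + r"]
        bonding_simps(2)[of r "k + r" "f (k + r)" "y r"] bonding_simps(2)[of r "k + r" "y r" "f (k + r)"]
      by (simp_all add: z_def)
    have "e \<otimes>\<^bsub>A\<^esub> a = a" "a \<otimes>\<^bsub>A\<^esub> e = a"
      using a e(1) fz by (auto intro!: h_inj closed simp: h_simps(3) f_def)
    moreover have "h a (k + r) = y r" for r
      unfolding a(2) z_def using yq[of r "k + r"] by simp
    ultimately show "\<exists>a\<in>carrier (corner A e). (\<lambda>r. h a (k + r)) = y"
      using a(1) by (intro bexI[of _ a]) auto
  qed (use e in \<open>auto simp: h_simps T_def f_def\<close>)
  then show ?thesis by (rule is_bounded_inverse_limitI[OF adm])
qed

section \<open>The unitized direct sum\<close>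

text \<open>Completeness is transported from the complex numbers: the isometry has range \<real> or
  the whole plane, and both are closed.\<close>

lemma real_or_complex_complete:
  fixes l :: "nat \<Rightarrow> 'k::real_or_complex"
  assumes "\<And>\<epsilon>. 0 < \<epsilon> \<Longrightarrow> \<exists>M. \<forall>i\<ge>M. \<forall>j\<ge>M. norm (l i - l j) < \<epsilon>"
  shows "\<exists>k. l \<longlonglongrightarrow> k"
proof -
  obtain \<phi> :: "'k \<Rightarrow> complex" where \<phi>: "\<And>x y. \<phi> (x + y) = \<phi> x + \<phi> y"
      "\<And>x. norm (\<phi> x) = norm x" "range \<phi> = \<real> \<or> range \<phi> = UNIV"
    using ex_real_or_complex_iso[where 'a = 'k] by blast
  have diff: "\<phi> (x - y) = \<phi> x - \<phi> y" for x y
    using \<phi>(1)[of "x - y" y] by simp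
  have "Cauchy (\<lambda>i. \<phi> (l i))"
    using assms by (simp add: Cauchy_iff \<phi>(2) flip: diff)
  then obtain z where z: "(\<lambda>i. \<phi> (l i)) \<longlonglongrightarrow> z"
    using Cauchy_convergent by (auto simp: convergent_def)
  have "closed (range \<phi>)" using \<phi>(3) closed_complex_Reals by auto
  then have "z \<in> range \<phi>" by (rule closed_sequentially[OF _ _ z]) simp
  then obtain k where "z = \<phi> k" by blast
  then have "(\<lambda>i. norm (l i - k)) \<longlonglongrightarrow> 0"
    using tendsto_norm_zero[OF LIM_zero[OF z]] by (simp add: \<phi>(2) flip: diff)
  then have "l \<longlonglongrightarrow> k" by (simp add: LIM_zero_iff tendsto_norm_zero_iff)
  then show ?thesis by blast
qed

lemma dsum_unitization_simps [simp]:
  "carrier (dsum_unitization u B) = dsum_carrier u B \<times> UNIV"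
  "\<one>\<^bsub>dsum_unitization u B\<^esub> = (\<lambda>n. \<zero>\<^bsub>B n\<^esub>, 1)"
  "\<zero>\<^bsub>dsum_unitization u B\<^esub> = (\<lambda>n. \<zero>\<^bsub>B n\<^esub>, 0)"
  "(b, l) \<otimes>\<^bsub>dsum_unitization u B\<^esub> (c, m) =
    (\<lambda>n. b n \<otimes>\<^bsub>B n\<^esub> c n \<oplus>\<^bsub>B n\<^esub> l \<odot>\<^bsub>B n\<^esub> c n \<oplus>\<^bsub>B n\<^esub> m \<odot>\<^bsub>B n\<^esub> b n, l * m)"
  "(b, l) \<oplus>\<^bsub>dsum_unitization u B\<^esub> (c, m) = (\<lambda>n. b n \<oplus>\<^bsub>B n\<^esub> c n, l + m)"
  "t \<odot>\<^bsub>dsum_unitization u B\<^esub> (b, l) = (\<lambda>n. t \<odot>\<^bsub>B n\<^esub> b n, t * l)"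
  "nrm (dsum_unitization u B) (b, l) = dsum_norm u B b + norm l"
  by (simp_all add: dsum_unitization_def)

text \<open>The units are not normalized and zero summands are allowed, so that the truncated sums
  are instances and their completeness needs no second proof.\<close>

locale unconditional_sum = normalized_unconditional smul u
  for smul :: "'k::real_or_complex \<Rightarrow> 'u::banach \<Rightarrow> 'u" and u +
  fixes B :: "nat \<Rightarrow> ('k, 'b) normed_algebra"
  assumes summand_banach_algebra: "unital_banach_algebra (B n)"
begin

sublocale B: unital_banach_algebra "B n" for n
  by (rule summand_banach_algebra)

abbreviation "D \<equiv> dsum_unitization u B"

declare B.smult_carrier [simp]

section \<open>Estimates in the direct sum\<close>

lemma dsum_carrierD:
  assumes "b \<in> dsum_carrier u B"
  shows "b n \<in> carrier (B n)" "summable (\<lambda>n. nrm (B n) (b n) *\<^sub>R u n)"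
  using assms by (auto simp: dsum_carrier_def)

lemma nrm_le_dsum_norm: "b \<in> dsum_carrier u B \<Longrightarrow> nrm (B n) (b n) \<le> dsum_norm u B b"
  using abs_le_norm_suminf[OF dsum_carrierD(2), of b n] B.nrm_nonneg[OF dsum_carrierD(1)]
  by (simp add: dsum_norm_def)

lemma dsum_norm_nonneg: "0 \<le> dsum_norm u B b"
  by (simp add: dsum_norm_def)

text \<open>Reduces closure and norm bounds for each operation to an inequality between norms of the
  coordinates.\<close>

lemma dsum_combination:
  assumes b: "b \<in> dsum_carrier u B" and c: "c \<in> dsum_carrier u B"
    and d: "\<And>n. d n \<in> carrier (B n)"
    and le: "\<And>n. nrm (B n) (d n) \<le> s * nrm (B n) (b n) + t * nrm (B n) (c n)"
    and st: "0 \<le> s" "0 \<le> t"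
  shows "d \<in> dsum_carrier u B" "dsum_norm u B d \<le> s * dsum_norm u B b + t * dsum_norm u B c"
proof -
  have abs: "\<bar>nrm (B n) (d n)\<bar> \<le> s * \<bar>nrm (B n) (b n)\<bar> + t * \<bar>nrm (B n) (c n)\<bar>" for n
    using le d dsum_carrierD(1)[OF b] dsum_carrierD(1)[OF c] by (simp add: B.nrm_nonneg)
  show "d \<in> dsum_carrier u B"
    unfolding dsum_carrier_def
    using d summable_combination[OF dsum_carrierD(2)[OF b] dsum_carrierD(2)[OF c] abs] by simp
  show "dsum_norm u B d \<le> s * dsum_norm u B b + t * dsum_norm u B c"
    unfolding dsum_norm_def
    by (rule norm_suminf_le_combination[OF dsum_carrierD(2)[OF b] dsum_carrierD(2)[OF c] abs st])
qed

lemma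
  assumes b: "b \<in> dsum_carrier u B" and c: "c \<in> dsum_carrier u B"
  shows dsum_add_closed: "(\<lambda>n. b n \<oplus>\<^bsub>B n\<^esub> c n) \<in> dsum_carrier u B"
    and dsum_norm_triangle:
      "dsum_norm u B (\<lambda>n. b n \<oplus>\<^bsub>B n\<^esub> c n) \<le> dsum_norm u B b + dsum_norm u B c"
proof -
  note bc = dsum_carrierD(1)[OF b] dsum_carrierD(1)[OF c]
  show "(\<lambda>n. b n \<oplus>\<^bsub>B n\<^esub> c n) \<in> dsum_carrier u B"
    by (rule dsum_combination(1)[OF b c, where s = 1 and t = 1]) (simp_all add: bc B.nrm_triangle)
  show "dsum_norm u B (\<lambda>n. b n \<oplus>\<^bsub>B n\<^esub> c n) \<le> dsum_norm u B b + dsum_norm u B c"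
    using dsum_combination(2)[OF b c, of "\<lambda>n. b n \<oplus>\<^bsub>B n\<^esub> c n" 1 1] by (simp add: bc B.nrm_triangle)
qed

lemma
  assumes b: "b \<in> dsum_carrier u B"
  shows dsum_smult_closed: "(\<lambda>n. t \<odot>\<^bsub>B n\<^esub> b n) \<in> dsum_carrier u B"
    and dsum_norm_smult: "dsum_norm u B (\<lambda>n. t \<odot>\<^bsub>B n\<^esub> b n) = norm t * dsum_norm u B b"
proof -
  note [simp] = dsum_carrierD(1)[OF b] B.nrm_smult
  show "(\<lambda>n. t \<odot>\<^bsub>B n\<^esub> b n) \<in> dsum_carrier u B"
    by (rule dsum_combination(1)[OF b b, where s = "norm t" and t = 0]) simp_all
  show "dsum_norm u B (\<lambda>n. t \<odot>\<^bsub>B n\<^esub> b n) = norm t * dsum_norm u B b"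
    unfolding dsum_norm_def
    using suminf_scaleR_right[OF dsum_carrierD(2)[OF b], of "norm t", symmetric] by simp
qed

lemma dsum_zero_closed [simp]: "(\<lambda>n. \<zero>\<^bsub>B n\<^esub>) \<in> dsum_carrier u B"
  by (simp add: dsum_carrier_def)

lemma dsum_norm_eq_0_iff:
  assumes b: "b \<in> dsum_carrier u B"
  shows "dsum_norm u B b = 0 \<longleftrightarrow> b = (\<lambda>n. \<zero>\<^bsub>B n\<^esub>)"
proof
  assume 0: "dsum_norm u B b = 0"
  show "b = (\<lambda>n. \<zero>\<^bsub>B n\<^esub>)"
  proof
    fix n
    have "nrm (B n) (b n) = 0"
      using nrm_le_dsum_norm[OF b, of n] B.nrm_nonneg[OF dsum_carrierD(1)[OF b], of n] 0 by simp
    then show "b n = \<zero>\<^bsub>B n\<^esub>" using B.nrm_eq_0_iff[OF dsum_carrierD(1)[OF b]] by blast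
  qed
qed (simp add: dsum_norm_def)

lemma
  fixes l m :: 'k
  assumes b: "b \<in> dsum_carrier u B" and c: "c \<in> dsum_carrier u B"
  defines "d \<equiv> \<lambda>n. b n \<otimes>\<^bsub>B n\<^esub> c n \<oplus>\<^bsub>B n\<^esub> l \<odot>\<^bsub>B n\<^esub> c n \<oplus>\<^bsub>B n\<^esub> m \<odot>\<^bsub>B n\<^esub> b n"
  shows dsum_mult_closed: "d \<in> dsum_carrier u B"
    and dsum_norm_mult_le: "dsum_norm u B d + norm (l * m) \<le>
      (dsum_norm u B b + norm l) * (dsum_norm u B c + norm m)"
proof -
  note [simp] = dsum_carrierD(1)[OF b] dsum_carrierD(1)[OF c]
  have dc: "d n \<in> carrier (B n)" for n by (simp add: d_def)
  \<comment> \<open>One factor \<open>nrm (B n) (b n)\<close> is replaced by the norm of b. Writing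
    \<beta> and \<gamma> for the norms of b and c, the bound (\<beta> + |l|) \<gamma> + |m| \<beta>
    becomes the product (\<beta> + |l|) (\<gamma> + |m|) once |l m| is added.\<close>
  have le: "nrm (B n) (d n) \<le>
      (dsum_norm u B b + norm l) * nrm (B n) (c n) + norm m * nrm (B n) (b n)" for n
  proof -
    have "nrm (B n) (d n) \<le>
        nrm (B n) (b n \<otimes>\<^bsub>B n\<^esub> c n \<oplus>\<^bsub>B n\<^esub> l \<odot>\<^bsub>B n\<^esub> c n) + nrm (B n) (m \<odot>\<^bsub>B n\<^esub> b n)"
      unfolding d_def by (rule B.nrm_triangle) simp_all
    also have "\<dots> \<le> nrm (B n) (b n \<otimes>\<^bsub>B n\<^esub> c n) + nrm (B n) (l \<odot>\<^bsub>B n\<^esub> c n) + nrm (B n) (m \<odot>\<^bsub>B n\<^esub> b n)"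
      by (intro add_right_mono B.nrm_triangle) simp_all
    also have "\<dots> \<le> nrm (B n) (b n) * nrm (B n) (c n) + norm l * nrm (B n) (c n) + norm m * nrm (B n) (b n)"
      by (intro add_mono B.nrm_mult_le) (simp_all add: B.nrm_smult)
    also have "\<dots> \<le> dsum_norm u B b * nrm (B n) (c n) + norm l * nrm (B n) (c n) + norm m * nrm (B n) (b n)"
      by (intro add_right_mono mult_right_mono nrm_le_dsum_norm b B.nrm_nonneg) simp
    finally show ?thesis by (simp add: algebra_simps)
  qed
  have nonneg: "0 \<le> dsum_norm u B b + norm l" using dsum_norm_nonneg by simp
  show "d \<in> dsum_carrier u B"
    by (rule dsum_combination(1)[OF c b dc le nonneg norm_ge_zero])
  show "dsum_norm u B d + norm (l * m) \<le> (dsum_norm u B b + norm l) * (dsum_norm u B c + norm m)"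
    using dsum_combination(2)[OF c b dc le nonneg norm_ge_zero]
    by (simp add: algebra_simps norm_mult)
qed

section \<open>The unitized sum is a Banach algebra\<close>

lemma dsum_abelian_group: "abelian_group D"
proof (rule abelian_groupI)
  fix x assume x: "x \<in> carrier D"
  obtain b l where [simp]: "x = (b, l)" by (cases x)
  have b: "b \<in> dsum_carrier u B" using x by simp
  show "\<exists>y\<in>carrier D. y \<oplus>\<^bsub>D\<^esub> x = \<zero>\<^bsub>D\<^esub>"
    using dsum_smult_closed[OF b, of "- 1"] dsum_carrierD(1)[OF b]
    by (intro bexI[of _ "(\<lambda>n. (- 1) \<odot>\<^bsub>B n\<^esub> b n, - l)"])
      (simp_all add: B.a_inv_eq_smult[symmetric] B.l_neg)
qed (auto simp: dsum_add_closed dsum_carrierD B.a_ac add_ac)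

lemma dsum_minus:
  assumes "b \<in> dsum_carrier u B" "c \<in> dsum_carrier u B"
  shows "(b, l) \<ominus>\<^bsub>D\<^esub> (c, m) = (\<lambda>n. b n \<ominus>\<^bsub>B n\<^esub> c n, l - m)"
proof -
  interpret D: abelian_group D by (rule dsum_abelian_group)
  have "\<ominus>\<^bsub>D\<^esub> (c, m) = (\<lambda>n. (- 1) \<odot>\<^bsub>B n\<^esub> c n, - m)"
    using dsum_smult_closed[OF assms(2), of "- 1"] dsum_carrierD(1)[OF assms(2)] assms(2)
    by (intro D.minus_equality) (simp_all add: B.a_inv_eq_smult[symmetric] B.l_neg)
  then show ?thesis
    using dsum_carrierD(1)[OF assms(2)] by (simp add: a_minus_def B.a_inv_eq_smult)
qed

lemma dsum_minus_closed:
  assumes "b \<in> dsum_carrier u B" "c \<in> dsum_carrier u B"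
  shows "(\<lambda>n. b n \<ominus>\<^bsub>B n\<^esub> c n) \<in> dsum_carrier u B"
  by (rule dsum_combination(1)[OF assms, where s = 1 and t = 1])
    (simp_all add: dsum_carrierD(1)[OF assms(1)] dsum_carrierD(1)[OF assms(2)] B.nrm_minus_le)

text \<open>Coordinates and scalar parts converge separately. The uniform Cauchy bound is kept on
  finite partial sums, where the limit in j may be taken termwise; the resulting bound gives both
  membership of x in the sum and convergence in norm.\<close>

lemma dsum_complete:
  assumes X: "\<And>i. X i \<in> carrier D"
    and Cauchy: "\<forall>\<epsilon>>0. \<exists>M. \<forall>i\<ge>M. \<forall>j\<ge>M. nrm D (X i \<ominus>\<^bsub>D\<^esub> X j) < \<epsilon>"
  shows "\<exists>x\<in>carrier D. (\<lambda>i::nat. nrm D (X i \<ominus>\<^bsub>D\<^esub> x)) \<longlonglongrightarrow> 0"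
proof -
  define b where "b = (\<lambda>i. fst (X i))"
  define l where "l = (\<lambda>i. snd (X i))"
  have X_eq: "X i = (b i, l i)" for i by (simp add: b_def l_def)
  have b: "b i \<in> dsum_carrier u B" for i using X[of i] by (simp add: X_eq)
  note bc [simp] = dsum_carrierD(1)[OF b]
  define \<delta> where "\<delta> = (\<lambda>i j n. nrm (B n) (b i n \<ominus>\<^bsub>B n\<^esub> b j n))"
  have \<delta>_sum: "norm (\<Sum>n\<in>F. \<delta> i j n *\<^sub>R u n) \<le> nrm D (X i \<ominus>\<^bsub>D\<^esub> X j)" if "finite F" for i j F
    using norm_sum_le_suminf[OF dsum_carrierD(2)[OF dsum_minus_closed[OF b b]] that, of i j]
    by (simp add: X_eq dsum_minus b dsum_norm_def \<delta>_def add_increasing2)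
  have l_le: "norm (l i - l j) \<le> nrm D (X i \<ominus>\<^bsub>D\<^esub> X j)" for i j
    using dsum_norm_nonneg by (simp add: X_eq dsum_minus b)
  have \<delta>_le: "\<delta> i j n \<le> nrm D (X i \<ominus>\<^bsub>D\<^esub> X j)" for i j n
    using \<delta>_sum[of "{n}" i j] B.nrm_nonneg[of "b i n \<ominus>\<^bsub>B n\<^esub> b j n" n] by (simp add: \<delta>_def)
  have "\<exists>x\<in>carrier (B n). (\<lambda>i. nrm (B n) (b i n \<ominus>\<^bsub>B n\<^esub> x)) \<longlonglongrightarrow> 0" for n
  proof (rule B.nrm_complete)
    show "\<forall>\<epsilon>>0. \<exists>M. \<forall>i\<ge>M. \<forall>j\<ge>M. nrm (B n) (b i n \<ominus>\<^bsub>B n\<^esub> b j n) < \<epsilon>"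
    proof (intro allI impI)
      fix \<epsilon> :: real assume "0 < \<epsilon>"
      then obtain M where M: "\<forall>i\<ge>M. \<forall>j\<ge>M. nrm D (X i \<ominus>\<^bsub>D\<^esub> X j) < \<epsilon>" using Cauchy by blast
      have "\<delta> i j n < \<epsilon>" if "M \<le> i" "M \<le> j" for i j
        using M \<delta>_le[of i j n] that by (meson le_less_trans)
      then show "\<exists>M. \<forall>i\<ge>M. \<forall>j\<ge>M. nrm (B n) (b i n \<ominus>\<^bsub>B n\<^esub> b j n) < \<epsilon>"
        unfolding \<delta>_def by blast
    qed
  qed simp
  then obtain x where x: "\<And>n. x n \<in> carrier (B n)"
    and x_lim: "\<And>n. (\<lambda>i. nrm (B n) (b i n \<ominus>\<^bsub>B n\<^esub> x n)) \<longlonglongrightarrow> 0"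
    by metis
  have "\<exists>k. l \<longlonglongrightarrow> k"
  proof (rule real_or_complex_complete)
    fix \<epsilon> :: real assume "0 < \<epsilon>"
    then obtain M where "\<forall>i\<ge>M. \<forall>j\<ge>M. nrm D (X i \<ominus>\<^bsub>D\<^esub> X j) < \<epsilon>" using Cauchy by blast
    then show "\<exists>M. \<forall>i\<ge>M. \<forall>j\<ge>M. norm (l i - l j) < \<epsilon>" using l_le by (meson le_less_trans)
  qed
  then obtain k where k: "l \<longlonglongrightarrow> k" by blast
  define \<eta> where "\<eta> = (\<lambda>i n. nrm (B n) (b i n \<ominus>\<^bsub>B n\<^esub> x n))"
  have \<delta>_lim: "(\<lambda>j. \<delta> i j n) \<longlonglongrightarrow> \<eta> i n" for i n
  proof (rule Lim_transform2[OF tendsto_const], rule Lim_null_comparison)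
    show "\<forall>\<^sub>F j in sequentially. norm (\<eta> i n - \<delta> i j n) \<le> nrm (B n) (b j n \<ominus>\<^bsub>B n\<^esub> x n)"
      \<comment> \<open>The two differences from \<open>b i n\<close> themselves differ by b_j - x,
        which tends to 0.\<close>
      using B.abs_nrm_diff_le[of "b i n \<ominus>\<^bsub>B n\<^esub> x n" n "b i n \<ominus>\<^bsub>B n\<^esub> b j n" for j]
        B.diff_diff_cancel_left[of "b i n" n "x n" "b j n" for j] x
      by (intro always_eventually) (simp add: \<eta>_def \<delta>_def)
  qed (rule x_lim)
  have \<eta>_sum: "\<exists>M. \<forall>i\<ge>M. \<forall>F. finite F \<longrightarrow> norm (\<Sum>n\<in>F. \<eta> i n *\<^sub>R u n) \<le> \<epsilon>" if "0 < \<epsilon>" for \<epsilon>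
  proof -
    obtain M where M: "\<forall>i\<ge>M. \<forall>j\<ge>M. nrm D (X i \<ominus>\<^bsub>D\<^esub> X j) < \<epsilon>" using Cauchy \<open>0 < \<epsilon>\<close> by blast
    have "norm (\<Sum>n\<in>F. \<eta> i n *\<^sub>R u n) \<le> \<epsilon>" if "M \<le> i" "finite F" for i F
    proof (rule LIMSEQ_le_const2)
      show "(\<lambda>j. norm (\<Sum>n\<in>F. \<delta> i j n *\<^sub>R u n)) \<longlonglongrightarrow> norm (\<Sum>n\<in>F. \<eta> i n *\<^sub>R u n)"
        by (intro tendsto_intros \<delta>_lim)
      show "\<exists>N. \<forall>j\<ge>N. norm (\<Sum>n\<in>F. \<delta> i j n *\<^sub>R u n) \<le> \<epsilon>"
      proof (intro exI[of _ M] allI impI)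
        fix j assume "M \<le> j"
        then have "nrm D (X i \<ominus>\<^bsub>D\<^esub> X j) < \<epsilon>" using M \<open>M \<le> i\<close> by blast
        then show "norm (\<Sum>n\<in>F. \<delta> i j n *\<^sub>R u n) \<le> \<epsilon>"
          using \<delta>_sum[OF \<open>finite F\<close>, of i j] by linarith
      qed
    qed
    then show ?thesis by blast
  qed
  have x_dsum: "x \<in> dsum_carrier u B"
    unfolding dsum_carrier_def
  proof (intro CollectI conjI allI x summable_if_approximable)
    fix \<epsilon> :: real assume "0 < \<epsilon>"
    then obtain i where i: "\<And>F. finite F \<Longrightarrow> norm (\<Sum>n\<in>F. \<eta> i n *\<^sub>R u n) \<le> \<epsilon>"
      using \<eta>_sum by blast
    \<comment> \<open>The reverse triangle inequality bounds the difference of the coefficients by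
      \<eta>, so the summable coefficients of one \<open>b i\<close> approximate those of x.\<close>
    have "norm (\<Sum>n\<in>F. (nrm (B n) (x n) - nrm (B n) (b i n)) *\<^sub>R u n) \<le> \<epsilon>" if "finite F" for F
    proof (rule order_trans[OF norm_sum_mono[OF that] i[OF that]])
      fix n
      have "\<bar>nrm (B n) (b i n) - nrm (B n) (x n)\<bar> \<le> \<eta> i n"
        unfolding \<eta>_def by (rule B.abs_nrm_diff_le) (simp_all add: x)
      then show "\<bar>nrm (B n) (x n) - nrm (B n) (b i n)\<bar> \<le> \<bar>\<eta> i n\<bar>" by linarith
    qed
    then show "\<exists>\<beta>. summable (\<lambda>n. \<beta> n *\<^sub>R u n) \<and>
        (\<forall>F. finite F \<longrightarrow> norm (\<Sum>n\<in>F. (nrm (B n) (x n) - \<beta> n) *\<^sub>R u n) \<le> \<epsilon>)"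
      using dsum_carrierD(2)[OF b[of i]] by (intro exI[of _ "\<lambda>n. nrm (B n) (b i n)"]) simp
  qed
  have "(\<lambda>i. dsum_norm u B (\<lambda>n. b i n \<ominus>\<^bsub>B n\<^esub> x n)) \<longlonglongrightarrow> 0"
  proof (rule LIMSEQ_I)
    fix \<epsilon> :: real assume "0 < \<epsilon>"
    then obtain M where M: "\<And>i F. M \<le> i \<Longrightarrow> finite F \<Longrightarrow> norm (\<Sum>n\<in>F. \<eta> i n *\<^sub>R u n) \<le> \<epsilon> / 2"
      using \<eta>_sum[of "\<epsilon> / 2"] by auto
    have "dsum_norm u B (\<lambda>n. b i n \<ominus>\<^bsub>B n\<^esub> x n) \<le> \<epsilon> / 2" if "M \<le> i" for i
      unfolding dsum_norm_def
      by (rule norm_suminf_le[OF dsum_carrierD(2)[OF dsum_minus_closed[OF b x_dsum]]])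
        (use M[OF that] in \<open>simp add: \<eta>_def\<close>)
    then show "\<exists>M. \<forall>i\<ge>M. norm (dsum_norm u B (\<lambda>n. b i n \<ominus>\<^bsub>B n\<^esub> x n) - 0) < \<epsilon>"
      using \<open>0 < \<epsilon>\<close> by (force simp: dsum_norm_nonneg intro: exI[of _ M])
  qed
  then have "(\<lambda>i. dsum_norm u B (\<lambda>n. b i n \<ominus>\<^bsub>B n\<^esub> x n) + norm (l i - k)) \<longlonglongrightarrow> 0 + 0"
    using k by (intro tendsto_add tendsto_norm_zero LIM_zero)
  then show ?thesis
    using x_dsum by (intro bexI[of _ "(x, k)"]) (simp_all add: X_eq dsum_minus b)
qed

lemma dsum_monoid: "monoid D"
proof (rule monoidI)
  fix x y z assume "x \<in> carrier D" "y \<in> carrier D" "z \<in> carrier D"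
  moreover obtain b l c m d k where "x = (b, l)" "y = (c, m)" "z = (d, k)"
    by (metis surj_pair)
  ultimately show "x \<otimes>\<^bsub>D\<^esub> y \<otimes>\<^bsub>D\<^esub> z = x \<otimes>\<^bsub>D\<^esub> (y \<otimes>\<^bsub>D\<^esub> z)"
    by (simp add: fun_eq_iff dsum_carrierD B.l_distr B.r_distr B.smult_mult_left
        B.smult_mult_right B.smult_laws B.m_assoc B.a_ac mult_ac flip: B.smult_laws(3))
qed (auto simp: dsum_mult_closed dsum_carrierD B.smult_zero_left B.smult_laws(4))

lemma dsum_banach_algebra: "unital_banach_algebra D"
proof (intro unital_banach_algebra.intro unital_banach_algebra_axioms.intro)
  show "ring D"
    by (rule ringI[OF dsum_abelian_group dsum_monoid])
      (auto simp: dsum_carrierD B.l_distr B.r_distr B.smult_laws B.a_ac algebra_simps)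
  show "Module.module scalar_ring D"
    by (rule moduleI[OF cring_scalar_ring dsum_abelian_group])
      (auto simp: scalar_ring_def dsum_smult_closed dsum_carrierD B.smult_laws algebra_simps)
next
  fix X :: "nat \<Rightarrow> (nat \<Rightarrow> 'b) \<times> 'k"
  assume "\<And>i. X i \<in> carrier D" "\<forall>\<epsilon>>0. \<exists>M. \<forall>i\<ge>M. \<forall>j\<ge>M. nrm D (X i \<ominus>\<^bsub>D\<^esub> X j) < \<epsilon>"
  then show "\<exists>x\<in>carrier D. (\<lambda>i. nrm D (X i \<ominus>\<^bsub>D\<^esub> x)) \<longlonglongrightarrow> 0"
    by (rule dsum_complete)
next
  fix x y assume "x \<in> carrier D" "y \<in> carrier D"
  moreover obtain b l c m where "x = (b, l)" "y = (c, m)" by (metis surj_pair)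
  ultimately show "nrm D (x \<oplus>\<^bsub>D\<^esub> y) \<le> nrm D x + nrm D y"
    using dsum_norm_triangle[of b c] norm_triangle_ineq[of l m] by simp
next
  fix x y assume "x \<in> carrier D" "y \<in> carrier D"
  moreover obtain b l c m where "x = (b, l)" "y = (c, m)" by (metis surj_pair)
  ultimately show "nrm D (x \<otimes>\<^bsub>D\<^esub> y) \<le> nrm D x * nrm D y"
    using dsum_norm_mult_le[of b c l m] by simp
next
  fix x assume "x \<in> carrier D"
  moreover obtain b l where "x = (b, l)" by (metis surj_pair)
  ultimately show "nrm D x = 0 \<longleftrightarrow> x = \<zero>\<^bsub>D\<^esub>"
    using dsum_norm_nonneg[of b] dsum_norm_eq_0_iff[of b] by (simp add: add_nonneg_eq_0_iff)
qed (auto simp: dsum_norm_nonneg dsum_norm_smult norm_mult distrib_left dsum_carrierD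
    B.smult_mult_left B.smult_mult_right B.smult_laws mult_ac
    simp flip: B.smult_laws(3))

section \<open>Finitely supported elements and finite dimension\<close>

definition single :: "nat \<Rightarrow> 'b \<Rightarrow> nat \<Rightarrow> 'b" where
  "single n x = (\<lambda>k. if k = n then x else \<zero>\<^bsub>B k\<^esub>)"

lemma finite_support_dsum_carrier:
  assumes "\<And>n. b n \<in> carrier (B n)" "\<And>n. N \<le> n \<Longrightarrow> b n = \<zero>\<^bsub>B n\<^esub>"
  shows "b \<in> dsum_carrier u B" "dsum_norm u B b = norm (\<Sum>n<N. nrm (B n) (b n) *\<^sub>R u n)"
proof -
  have "nrm (B n) (b n) *\<^sub>R u n = 0" if "n \<notin> {..<N}" for n
    using assms(2)[of n] that by simp
  then have sums: "(\<lambda>n. nrm (B n) (b n) *\<^sub>R u n) sums (\<Sum>n<N. nrm (B n) (b n) *\<^sub>R u n)"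
    by (intro sums_finite) auto
  show "b \<in> dsum_carrier u B" using assms(1) sums_summable[OF sums] by (simp add: dsum_carrier_def)
  show "dsum_norm u B b = norm (\<Sum>n<N. nrm (B n) (b n) *\<^sub>R u n)"
    using sums_unique[OF sums] by (simp add: dsum_norm_def)
qed

lemma single_carrier:
  assumes "x \<in> carrier (B n)"
  shows "single n x \<in> dsum_carrier u B"
  by (rule finite_support_dsum_carrier(1)[where N = "Suc n"]) (use assms in \<open>auto simp: single_def\<close>)

lemma dsum_norm_single:
  assumes "x \<in> carrier (B n)"
  shows "dsum_norm u B (single n x) = nrm (B n) x"
proof -
  have "dsum_norm u B (single n x) = norm (\<Sum>k<Suc n. nrm (B k) (single n x k) *\<^sub>R u k)"
    by (rule finite_support_dsum_carrier(2)) (use assms in \<open>auto simp: single_def\<close>)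
  also have "(\<Sum>k<Suc n. nrm (B k) (single n x k) *\<^sub>R u k) = nrm (B n) x *\<^sub>R u n"
    by (simp add: single_def)
  finally show ?thesis using B.nrm_nonneg[OF assms] by simp
qed

text \<open>The unit together with copies of spanning sets of the first N summands spans: an element
  is assembled coordinate by coordinate, and its scalar part is a multiple of the unit.\<close>

lemma dsum_finite_dimensional:
  assumes fin: "\<And>n. finite_dimensional (B n)"
    and supp: "\<And>n. N \<le> n \<Longrightarrow> carrier (B n) = {\<zero>\<^bsub>B n\<^esub>}"
  shows "finite_dimensional D"
proof -
  interpret D: unital_banach_algebra D by (rule dsum_banach_algebra)
  have "\<forall>n. \<exists>S. finite S \<and> S \<subseteq> carrier (B n) \<and> carrier (B n) \<subseteq> B.lin_span n S"
    using fin by (simp add: B.finite_dimensional_iff)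
  then obtain S where S: "\<And>n. finite (S n)" "\<And>n. S n \<subseteq> carrier (B n)"
      "\<And>n. carrier (B n) \<subseteq> B.lin_span n (S n)"
    by metis
  define \<iota> :: "nat \<Rightarrow> 'b \<Rightarrow> (nat \<Rightarrow> 'b) \<times> 'k" where "\<iota> = (\<lambda>n x. (single n x, 0))"
  define G where "G = insert \<one>\<^bsub>D\<^esub> (\<Union>n<N. \<iota> n ` S n)"
  have \<iota>: "\<iota> n x \<in> carrier D" if "x \<in> carrier (B n)" for n x
    using single_carrier[OF that] by (simp add: \<iota>_def)
  have G: "finite G" "G \<subseteq> carrier D"
    using S \<iota> by (auto simp: G_def subset_eq simp del: dsum_unitization_simps(1)) simp
  have \<iota>_span: "\<iota> n x \<in> D.lin_span G" if n: "n < N" and x: "x \<in> carrier (B n)" for n x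
  proof (rule linear_image_lin_span[OF summand_banach_algebra D.unital_banach_algebra_axioms])
    show "x \<in> B.lin_span n (S n)" using x S(3) by blast
    show "\<iota> n ` S n \<subseteq> G" using n by (auto simp: G_def)
  qed (use S G \<iota> in \<open>auto simp: \<iota>_def single_def fun_eq_iff\<close>)
  have "(b, l) \<in> D.lin_span G" if b: "b \<in> dsum_carrier u B" for b and l :: 'k
  proof -
    note bc = dsum_carrierD(1)[OF b]
    have trunc: "(\<lambda>n. if n < k then b n else \<zero>\<^bsub>B n\<^esub>, 0) \<in> D.lin_span G" if "k \<le> N" for k
      using that
    proof (induction k)
      case 0
      then show ?case using D.lin_span_zero[OF G(2)] by simp
    next
      case (Suc k)
      have "(\<lambda>n. if n < Suc k then b n else \<zero>\<^bsub>B n\<^esub>, 0) =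
          (\<lambda>n. if n < k then b n else \<zero>\<^bsub>B n\<^esub>, 0) \<oplus>\<^bsub>D\<^esub> \<iota> k (b k)"
        using bc by (auto simp: \<iota>_def single_def fun_eq_iff less_Suc_eq)
      then show ?case using Suc \<iota>_span[of k "b k"] bc D.lin_span_add[OF G(2)] by simp
    qed
    have "(\<lambda>n. if n < N then b n else \<zero>\<^bsub>B n\<^esub>) = b"
    proof
      fix n
      show "(if n < N then b n else \<zero>\<^bsub>B n\<^esub>) = b n" using bc[of n] supp[of n] by auto
    qed
    then have eq: "(b, l) = (\<lambda>n. if n < N then b n else \<zero>\<^bsub>B n\<^esub>, 0) \<oplus>\<^bsub>D\<^esub> l \<odot>\<^bsub>D\<^esub> \<one>\<^bsub>D\<^esub>"
      using bc by (simp add: fun_eq_iff)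
    have "l \<odot>\<^bsub>D\<^esub> \<one>\<^bsub>D\<^esub> \<in> D.lin_span G"
      using G by (intro D.lin_span_smult D.lin_span_base) (auto simp: G_def)
    then show ?thesis unfolding eq by (rule D.lin_span_add[OF G(2) trunc[OF order_refl]])
  qed
  then have "carrier D \<subseteq> D.lin_span G" by auto
  then show ?thesis unfolding D.finite_dimensional_iff using G by blast
qed

end

section \<open>Boundedly complete sums of limits\<close>

locale sum_of_limits = unconditional_sum smul u B
  for smul :: "'k::real_or_complex \<Rightarrow> 'u::banach \<Rightarrow> 'u" and u
    and B :: "nat \<Rightarrow> ('k, 'b) normed_algebra" +
  fixes S :: "nat \<Rightarrow> nat \<Rightarrow> ('k, 'c) normed_algebra" and p h
  assumes summand_limit: "limit_representation (S n) (p n) (B n) (h n)"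
begin

sublocale L: limit_representation "S n" "p n" "B n" "h n" for n
  by (rule summand_limit)

text \<open>The same r serves as cutoff and as level in every summand, a diagonal choice that turns
  countably many systems into one.\<close>

definition trunc :: "nat \<Rightarrow> nat \<Rightarrow> ('k, 'c) normed_algebra" where
  "trunc r n = corner (S n r) (if n < r then \<one>\<^bsub>S n r\<^esub> else \<zero>\<^bsub>S n r\<^esub>)"

lemma trunc_simps [simp]:
  "\<zero>\<^bsub>trunc r n\<^esub> = \<zero>\<^bsub>S n r\<^esub>"
  "x \<otimes>\<^bsub>trunc r n\<^esub> y = x \<otimes>\<^bsub>S n r\<^esub> y" "x \<oplus>\<^bsub>trunc r n\<^esub> y = x \<oplus>\<^bsub>S n r\<^esub> y"
  "c \<odot>\<^bsub>trunc r n\<^esub> x = c \<odot>\<^bsub>S n r\<^esub> x" "nrm (trunc r n) x = nrm (S n r) x"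
  by (simp_all add: trunc_def)

lemma trunc_carrier_iff:
  "x \<in> carrier (trunc r n) \<longleftrightarrow> x \<in> carrier (S n r) \<and> (r \<le> n \<longrightarrow> x = \<zero>\<^bsub>S n r\<^esub>)"
  by (auto simp: trunc_def)

sublocale T: unconditional_sum smul u "trunc r" for r
  by (intro unconditional_sum.intro unconditional_sum_axioms.intro normalized_unconditional_axioms)
    (simp add: trunc_def L.S.corner_banach_algebra)

lemma
  assumes "\<And>n. b n \<in> carrier (trunc r n)"
  shows trunc_dsum_carrier: "b \<in> dsum_carrier u (trunc r)"
    and trunc_dsum_norm: "dsum_norm u (trunc r) b = norm (\<Sum>n<r. nrm (S n r) (b n) *\<^sub>R u n)"
  using T.finite_support_dsum_carrier[of b r r] assms by (auto simp: trunc_carrier_iff)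

lemma trunc_dsum_carrier_iff:
  "b \<in> dsum_carrier u (trunc r) \<longleftrightarrow> (\<forall>n. b n \<in> carrier (trunc r n))"
  using trunc_dsum_carrier T.dsum_carrierD(1) by blast

abbreviation "trunc_sum r \<equiv> dsum_unitization u (trunc r)"

definition bonding :: "nat \<Rightarrow> nat \<Rightarrow> (nat \<Rightarrow> 'c) \<times> 'k \<Rightarrow> (nat \<Rightarrow> 'c) \<times> 'k" where
  "bonding r s = (\<lambda>(b, l). (\<lambda>n. if n < r then p n r s (b n) else \<zero>\<^bsub>S n r\<^esub>, l))"

declare L.S.smult_carrier [simp]

lemma truncated_system_admissible: "admissible_system trunc_sum bonding"
proof (rule admissible_systemI)
  fix r
  show "unital_banach_algebra (trunc_sum r)" by (rule T.dsum_banach_algebra)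
  show "finite_dimensional (trunc_sum r)"
  proof (rule T.dsum_finite_dimensional[where N = r])
    show "finite_dimensional (trunc r n)" for n
      unfolding trunc_def by (intro L.S.corner_finite_dimensional L.finite_dim) simp_all
    show "carrier (trunc r n) = {\<zero>\<^bsub>trunc r n\<^esub>}" if "r \<le> n" for n
      using that by (auto simp: trunc_carrier_iff)
  qed
  show "nrm (trunc_sum r) \<one>\<^bsub>trunc_sum r\<^esub> = 1" by (simp add: dsum_norm_def)
next
  fix r s :: nat assume rs: "r \<le> s"
  show "bonding r s \<in> unital_algebra_hom (trunc_sum s) (trunc_sum r)"
    unfolding unital_algebra_hom_def using rs
    by (auto intro!: ring_hom_memI simp: bonding_def trunc_dsum_carrier_iff trunc_carrier_iff fun_eq_iff)
next
  fix r x assume "x \<in> carrier (trunc_sum r)"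
  then show "bonding r r x = x"
    by (auto simp: bonding_def trunc_dsum_carrier_iff trunc_carrier_iff fun_eq_iff)
next
  fix r s t x assume "r \<le> s" "s \<le> t" "x \<in> carrier (trunc_sum t)"
  then show "bonding r s (bonding s t x) = bonding r t x"
    by (auto simp: bonding_def trunc_dsum_carrier_iff trunc_carrier_iff fun_eq_iff L.bonding_comp)
next
  fix r s x assume rs: "r \<le> s" and x: "x \<in> carrier (trunc_sum s)"
  obtain b l where [simp]: "x = (b, l)" by (cases x)
  have b: "b n \<in> carrier (trunc s n)" for n using x by (simp add: trunc_dsum_carrier_iff)
  then have bS: "b n \<in> carrier (S n s)" for n by (simp add: trunc_carrier_iff)
  define c where "c = (\<lambda>n. if n < r then p n r s (b n) else \<zero>\<^bsub>S n r\<^esub>)"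
  have c: "c n \<in> carrier (trunc r n)" for n
    using bS rs by (simp add: c_def trunc_carrier_iff)
  have "norm (\<Sum>n<r. nrm (S n r) (c n) *\<^sub>R u n) \<le> norm (\<Sum>n<r. nrm (S n s) (b n) *\<^sub>R u n)"
    using bS rs by (intro norm_sum_mono) (simp_all add: c_def L.S.nrm_nonneg L.bonding_contractive)
  also have "\<dots> \<le> norm (\<Sum>n<s. nrm (S n s) (b n) *\<^sub>R u n)"
    using rs by (intro norm_sum_subset_mono) auto
  finally show "nrm (trunc_sum r) (bonding r s x) \<le> nrm (trunc_sum s) x"
    using b c by (simp add: bonding_def c_def[symmetric] trunc_dsum_norm)
next
  fix r s x and \<epsilon> :: real assume rs: "r \<le> s" and x: "x \<in> carrier (trunc_sum r)" and \<epsilon>: "0 < \<epsilon>"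
  obtain b l where [simp]: "x = (b, l)" by (cases x)
  have b: "b n \<in> carrier (trunc r n)" for n using x by (simp add: trunc_dsum_carrier_iff)
  then have bS: "b n \<in> carrier (S n r)" for n by (simp add: trunc_carrier_iff)
  \<comment> \<open>At most r coordinates are lifted with error \<delta> each, and the basis is
    normalized, so the total error is at most r \<delta> < \<epsilon>. The added 1 covers r =
    0.\<close>
  define \<delta> where "\<delta> = \<epsilon> / (real r + 1)"
  have "0 < \<delta>" using \<epsilon> by (simp add: \<delta>_def)
  then have "\<forall>n. \<exists>y\<in>carrier (S n s). p n r s y = b n \<and> nrm (S n s) y < nrm (S n r) (b n) + \<delta>"
    using L.ex_lift[OF rs bS] by blast
  then obtain y where y: "\<And>n. y n \<in> carrier (S n s)" "\<And>n. p n r s (y n) = b n"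
    "\<And>n. nrm (S n s) (y n) < nrm (S n r) (b n) + \<delta>"
    by metis
  define c where "c = (\<lambda>n. if n < r then y n else \<zero>\<^bsub>S n s\<^esub>)"
  have c: "c n \<in> carrier (trunc s n)" for n
    using y(1) rs by (simp add: c_def trunc_carrier_iff)
  have "(\<Sum>n<s. nrm (S n s) (c n) *\<^sub>R u n) = (\<Sum>n<r. nrm (S n s) (c n) *\<^sub>R u n)"
    using rs by (intro sum.mono_neutral_right) (auto simp: c_def)
  also have "norm \<dots> \<le> norm (\<Sum>n<r. (nrm (S n r) (b n) + \<delta>) *\<^sub>R u n)"
  proof (rule norm_sum_mono)
    fix n assume "n \<in> {..<r}"
    then show "\<bar>nrm (S n s) (c n)\<bar> \<le> \<bar>nrm (S n r) (b n) + \<delta>\<bar>"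
      using L.S.nrm_nonneg[OF y(1)] y(3)[of n] by (simp add: c_def)
  qed simp
  also have "\<dots> \<le> norm (\<Sum>n<r. nrm (S n r) (b n) *\<^sub>R u n) + norm (\<Sum>n<r. \<delta> *\<^sub>R u n)"
    by (simp add: scaleR_left_distrib sum.distrib norm_triangle_ineq)
  also have "norm (\<Sum>n<r. \<delta> *\<^sub>R u n) \<le> (\<Sum>n<r. \<delta>)"
    using \<open>0 < \<delta>\<close> by (intro order_trans[OF norm_sum]) simp
  also have "(\<Sum>n<r. \<delta>) < \<epsilon>"
    using \<epsilon> by (simp add: \<delta>_def field_simps)
  finally have "nrm (trunc_sum s) (c, l) < nrm (trunc_sum r) x + \<epsilon>"
    using b c by (simp add: trunc_dsum_norm)
  moreover have "bonding r s (c, l) = x"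
    using y(2) b by (auto simp: bonding_def c_def fun_eq_iff trunc_carrier_iff)
  moreover have "(c, l) \<in> carrier (trunc_sum s)"
    using c by (simp add: trunc_dsum_carrier_iff)
  ultimately show "\<exists>y\<in>carrier (trunc_sum s). bonding r s y = x \<and> nrm (trunc_sum s) y < nrm (trunc_sum r) x + \<epsilon>" by blast
qed

section \<open>The sum as the limit of its truncations\<close>

definition embed :: "(nat \<Rightarrow> 'b) \<times> 'k \<Rightarrow> nat \<Rightarrow> (nat \<Rightarrow> 'c) \<times> 'k" where
  "embed = (\<lambda>(b, l) r. (\<lambda>n. if n < r then h n (b n) r else \<zero>\<^bsub>S n r\<^esub>, l))"

lemma h_zero: "h n \<zero>\<^bsub>B n\<^esub> r = \<zero>\<^bsub>S n r\<^esub>"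
  using L.h_simps(5)[of "\<zero>\<^bsub>B n\<^esub>" n 0 r] L.h_simps(1)[of "\<zero>\<^bsub>B n\<^esub>" n r]
  by (simp add: L.S.smult_zero_left)

lemma is_bounded_inverse_limit_dsum:
  assumes complete: "boundedly_complete smul u"
  shows "is_bounded_inverse_limit D"
proof -
  interpret Q: admissible trunc_sum bonding by unfold_locales (rule truncated_system_admissible)
  have trunc_embed: "(\<lambda>n. if n < r then h n (b n) r else \<zero>\<^bsub>S n r\<^esub>) n \<in> carrier (trunc r n)"
    if "b \<in> dsum_carrier u B" for b r n
    using L.h_simps(1)[OF dsum_carrierD(1)[OF that]] by (simp add: trunc_carrier_iff)
  have "isometrically_isomorphic D (bounded_inverse_limit trunc_sum bonding)"
  proof (rule Q.isometrically_isomorphic_limitI[where h = embed])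
    fix x assume x: "x \<in> carrier D"
    obtain b l where x_eq: "x = (b, l)" by (cases x)
    have b: "b \<in> dsum_carrier u B" using x by (simp add: x_eq)
    show "Q.coherent (embed x)"
      using trunc_embed[OF b] dsum_carrierD(1)[OF b]
      by (auto simp: Q.coherent_def x_eq embed_def bonding_def trunc_dsum_carrier_iff L.h_simps fun_eq_iff)
    have "nrm (trunc_sum r) (embed x r) = norm (\<Sum>n<r. nrm (S n r) (h n (b n) r) *\<^sub>R u n) + norm l" for r
      using trunc_dsum_norm[OF trunc_embed[OF b]] by (simp add: x_eq embed_def)
    moreover have "(\<lambda>r. norm (\<Sum>n<r. nrm (S n r) (h n (b n) r) *\<^sub>R u n)) \<longlonglongrightarrow> dsum_norm u B b"
      unfolding dsum_norm_def
    proof (rule tendsto_norm_truncated_sum[OF dsum_carrierD(2)[OF b]])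
      fix n
      have bn: "b n \<in> carrier (B n)" by (rule dsum_carrierD(1)[OF b])
      show "(\<lambda>r. nrm (S n r) (h n (b n) r)) \<longlonglongrightarrow> nrm (B n) (b n)" by (rule L.h_lim[OF bn])
      show "\<bar>nrm (S n r) (h n (b n) r)\<bar> \<le> \<bar>nrm (B n) (b n)\<bar>" for r
        using L.h_le[OF bn, of r] L.S.nrm_nonneg[OF L.h_simps(1)[OF bn], of r] by simp
    qed
    ultimately show "(\<lambda>r. nrm (trunc_sum r) (embed x r)) \<longlonglongrightarrow> nrm D x"
      by (auto simp: x_eq intro!: tendsto_intros)
  next
    fix x y assume xy: "x \<in> carrier D" "y \<in> carrier D" "embed x = embed y"
    obtain b l c m where eq: "x = (b, l)" "y = (c, m)" by (metis surj_pair)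
    have bc: "b n \<in> carrier (B n)" "c n \<in> carrier (B n)" for n
      using xy(1,2) by (auto simp: eq dsum_carrierD)
    have eqr: "(if n < r then h n (b n) r else \<zero>\<^bsub>S n r\<^esub>) = (if n < r then h n (c n) r else \<zero>\<^bsub>S n r\<^esub>)"
      and "l = m" for n r
      using fun_cong[OF xy(3), of r] by (auto simp: eq embed_def fun_eq_iff)
    have "h n (b n) r = h n (c n) r" for n r
    proof -
      \<comment> \<open>Summand n is visible only at stages beyond n, so coordinate r is compared at
        a stage that is also at least r and then projected down.\<close>
      let ?s = "max r (Suc n)"
      have "h n (b n) ?s = h n (c n) ?s" using eqr[of n ?s] by (simp add: less_max_iff_disj)
      then have "p n r ?s (h n (b n) ?s) = p n r ?s (h n (c n) ?s)" by simp
      then show ?thesis using bc by (simp add: L.h_simps(2))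
    qed
    then have "b n = c n" for n using bc L.h_inj by blast
    then show "x = y" using \<open>l = m\<close> by (auto simp: eq)
  next
    fix y C assume y: "Q.coherent y" "\<And>r. nrm (trunc_sum r) (y r) \<le> C"
    define c where "c = (\<lambda>r. fst (y r))"
    define l where "l = snd (y 0)"
    have "snd (y r) = l" for r
      using arg_cong[OF Q.coherentD(2)[OF y(1), of 0 r], of snd] by (simp add: bonding_def l_def split_beta)
    then have y_eq: "y r = (c r, l)" for r by (metis c_def prod.collapse)
    have c: "c r n \<in> carrier (trunc r n)" for r n
      using Q.coherentD(1)[OF y(1), of r] by (simp add: y_eq trunc_dsum_carrier_iff)
    then have cS: "c r n \<in> carrier (S n r)" for r n by (simp add: trunc_carrier_iff)
    have pc: "p n r s (c s n) = c r n" if "r \<le> s" "n < r" for n r s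
      using fun_cong[OF arg_cong[OF Q.coherentD(2)[OF y(1) that(1)], of fst], of n] that
      by (simp add: bonding_def y_eq)
    have sum_c: "norm (\<Sum>n<r. nrm (S n r) (c r n) *\<^sub>R u n) \<le> C - norm l" for r
      using y(2)[of r] trunc_dsum_norm[OF c] by (simp add: y_eq)
    have c_le: "nrm (S n r) (c r n) \<le> C" for r n
    proof (cases "n < r")
      case True
      then have "\<bar>nrm (S n r) (c r n)\<bar> \<le> norm (\<Sum>n<r. nrm (S n r) (c r n) *\<^sub>R u n)"
        by (intro abs_le_norm_sum) simp_all
      then show ?thesis using sum_c[of r] norm_ge_zero[of l] by linarith
    next
      case False
      then have "nrm (S n r) (c r n) = 0" using c[of r n] by (simp add: trunc_carrier_iff)
      \<comment> \<open>The empty sum in \<open>sum_c\<close> gives norm l \<le> C and so C \<ge>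
        0.\<close>
      then show ?thesis using sum_c[of 0] order_trans[OF norm_ge_zero[of l], of C] by simp
    qed
    \<comment> \<open>For r \<le> n the entry \<open>c r n\<close> is zero only because of
      truncation. The true coordinate comes from a stage at which summand n is present; by
      \<open>z_eq\<close> any such stage \<ge> r gives the same value.\<close>
    define z where "z = (\<lambda>n r. p n r (max r (Suc n)) (c (max r (Suc n)) n))"
    have z_eq: "z n r = p n r s (c s n)" if "r \<le> s" "n < s" for n r s
    proof -
      let ?t = "max r (Suc n)"
      have t: "r \<le> ?t" "?t \<le> s" "n < ?t" using that by auto
      show ?thesis
        unfolding z_def using L.bonding_comp[OF t(1,2) cS[of s n]] pc[OF t(2,3)] by simp
    qed
    have "\<exists>b. b \<in> carrier (B n) \<and> h n b = z n" for n
    proof (rule L.h_surj)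
      show "L.coherent n (z n)"
        unfolding L.coherent_def
      proof (intro conjI allI impI)
        show "z n r \<in> carrier (S n r)" for r using cS by (simp add: z_def)
        fix r s :: nat assume "r \<le> s"
        then show "p n r s (z n s) = z n r"
          using z_eq[of r "max s (Suc n)" n] z_eq[of s "max s (Suc n)" n]
            L.bonding_comp[of r s "max s (Suc n)" _ n] cS by (simp add: max.coboundedI1 less_max_iff_disj)
      qed
      show "nrm (S n r) (z n r) \<le> C" for r
        unfolding z_def by (rule order_trans[OF L.bonding_contractive c_le]) (simp_all add: cS)
    qed blast
    then obtain b where b: "\<And>n. b n \<in> carrier (B n)" "\<And>n. h n (b n) = z n" by metis
    have hb: "h n (b n) r = c r n" if "n < r" for n r
      using b(2) z_eq[of r r n] that cS by simp
    \<comment> \<open>Each coordinate now has a preimage, but the sequence b need not yet belong to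
      the sum. For fixed N its partial sum is the limit in r of sums that, once r \<ge> N, are part
      of those bounded in \<open>sum_c\<close>.\<close>
    have "summable (\<lambda>n. nrm (B n) (b n) *\<^sub>R u n)"
    proof (rule boundedly_completeD[OF complete])
      fix N
      show "norm (\<Sum>n<N. nrm (B n) (b n) *\<^sub>R u n) \<le> C"
      proof (rule LIMSEQ_le_const2)
        show "(\<lambda>r. norm (\<Sum>n<N. nrm (S n r) (h n (b n) r) *\<^sub>R u n)) \<longlonglongrightarrow>
            norm (\<Sum>n<N. nrm (B n) (b n) *\<^sub>R u n)"
          by (intro tendsto_intros L.h_lim b)
        have "norm (\<Sum>n<N. nrm (S n r) (h n (b n) r) *\<^sub>R u n) \<le> C" if "N \<le> r" for r
        proof -
          have "(\<Sum>n<N. nrm (S n r) (h n (b n) r) *\<^sub>R u n) = (\<Sum>n<N. nrm (S n r) (c r n) *\<^sub>R u n)"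
            using that by (intro sum.cong) (simp_all add: hb)
          also have "norm \<dots> \<le> norm (\<Sum>n<r. nrm (S n r) (c r n) *\<^sub>R u n)"
            using that by (intro norm_sum_subset_mono) auto
          also have "\<dots> \<le> C" using sum_c[of r] norm_ge_zero[of l] by linarith
          finally show ?thesis .
        qed
        then show "\<exists>R. \<forall>r\<ge>R. norm (\<Sum>n<N. nrm (S n r) (h n (b n) r) *\<^sub>R u n) \<le> C" by blast
      qed
    qed
    then have "b \<in> dsum_carrier u B" using b(1) by (simp add: dsum_carrier_def)
    moreover have "embed (b, l) r = y r" for r
      using hb c[of r] by (auto simp: embed_def y_eq fun_eq_iff trunc_carrier_iff)
    ultimately show "\<exists>x\<in>carrier D. embed x = y" by (intro bexI[of _ "(b, l)"]) auto
  qed (auto simp: embed_def fun_eq_iff L.h_simps dsum_carrierD h_zero)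
  then show ?thesis by (rule is_bounded_inverse_limitI[OF truncated_system_admissible])
qed

end

section \<open>Consequences of being a limit\<close>

locale unital_sum = unconditional_sum smul u B
  for smul :: "'k::real_or_complex \<Rightarrow> 'u::banach \<Rightarrow> 'u" and u
    and B :: "nat \<Rightarrow> ('k, 'b) normed_algebra" +
  assumes nrm_summand_one [simp]: "nrm (B n) \<one>\<^bsub>B n\<^esub> = 1"
begin

definition unit_at :: "nat \<Rightarrow> (nat \<Rightarrow> 'b) \<times> 'k" where
  "unit_at n = (single n \<one>\<^bsub>B n\<^esub>, 0)"

lemma unit_at_carrier: "unit_at n \<in> carrier D"
  by (simp add: unit_at_def single_carrier)

text \<open>Multiplication by \<open>unit_at n\<close> from either side projects onto summand n,
  where I becomes the unit of \<open>B n\<close>; hence the scalar part reappears there.\<close>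

lemma unit_at_mult:
  assumes "b \<in> dsum_carrier u B"
  shows "unit_at n \<otimes>\<^bsub>D\<^esub> (b, l) = (single n (b n \<oplus>\<^bsub>B n\<^esub> l \<odot>\<^bsub>B n\<^esub> \<one>\<^bsub>B n\<^esub>), 0)"
    and "(b, l) \<otimes>\<^bsub>D\<^esub> unit_at n = (single n (b n \<oplus>\<^bsub>B n\<^esub> l \<odot>\<^bsub>B n\<^esub> \<one>\<^bsub>B n\<^esub>), 0)"
  using dsum_carrierD(1)[OF assms] by (auto simp: unit_at_def single_def fun_eq_iff B.smult_zero_left)

lemma unit_at_idem: "unit_at n \<otimes>\<^bsub>D\<^esub> unit_at n = unit_at n"
  using unit_at_mult(1)[OF single_carrier[of "\<one>\<^bsub>B n\<^esub>" n], of n 0]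
  by (simp add: unit_at_def single_def B.smult_zero_left)

lemma unit_at_orthogonal: "m \<noteq> n \<Longrightarrow> unit_at m \<otimes>\<^bsub>D\<^esub> unit_at n = \<zero>\<^bsub>D\<^esub>"
  using unit_at_mult(1)[OF single_carrier[of "\<one>\<^bsub>B n\<^esub>" n], of m 0]
  by (simp add: unit_at_def single_def B.smult_zero_left fun_eq_iff)

text \<open>The summand is a copy of the corner at \<open>unit_at n\<close>: being fixed by this
  idempotent forces the scalar part and all other coordinates to vanish.\<close>

lemma summand_is_bounded_inverse_limit:
  assumes "is_bounded_inverse_limit D"
  shows "is_bounded_inverse_limit (B n)"
proof (rule is_bounded_inverse_limit_isomorphic)
  interpret D: unital_banach_algebra D by (rule dsum_banach_algebra)
  show "is_bounded_inverse_limit (corner D (unit_at n))"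
  proof (rule corner_is_bounded_inverse_limit[OF assms _ unit_at_carrier unit_at_idem])
    show "nrm D (unit_at n) = 1" by (simp add: unit_at_def dsum_norm_single)
  qed (rule D.m_closed)
  let ?\<iota> = "\<lambda>x. (single n x, 0 :: 'k)"
  have \<iota>: "?\<iota> x \<in> carrier (corner D (unit_at n))" if "x \<in> carrier (B n)" for x
    using that unit_at_mult[OF single_carrier[OF that], where n = n and l = 0] single_carrier[OF that]
    by (simp add: B.smult_zero_left) (simp add: single_def)
  have "?\<iota> \<in> unital_algebra_hom (B n) (corner D (unit_at n))"
    unfolding unital_algebra_hom_def using \<iota>
    by (auto intro!: ring_hom_memI simp del: corner_simps(1) dsum_unitization_simps(1)
        simp: single_def fun_eq_iff unit_at_def B.smult_zero_left)
  moreover have "bij_betw ?\<iota> (carrier (B n)) (carrier (corner D (unit_at n)))"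
  proof (rule bij_betwI')
    fix x y
    show "?\<iota> x = ?\<iota> y \<longleftrightarrow> x = y" by (auto simp: single_def fun_eq_iff)
  next
    fix y assume "y \<in> carrier (corner D (unit_at n))"
    moreover obtain b l where "y = (b, l)" by (cases y)
    ultimately have b: "b \<in> dsum_carrier u B" and eb: "unit_at n \<otimes>\<^bsub>D\<^esub> (b, l) = (b, l)"
      and y: "y = (b, l)" by auto
    have "l = 0" "single n (b n \<oplus>\<^bsub>B n\<^esub> l \<odot>\<^bsub>B n\<^esub> \<one>\<^bsub>B n\<^esub>) = b"
      using eb unfolding unit_at_mult(1)[OF b] by auto
    then show "\<exists>x\<in>carrier (B n). y = ?\<iota> x"
      using dsum_carrierD(1)[OF b] y
      by (intro bexI[of _ "b n"]) (simp_all add: B.smult_zero_left)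
  qed (rule \<iota>)
  moreover have "nrm (corner D (unit_at n)) (?\<iota> x) = nrm (B n) x" if "x \<in> carrier (B n)" for x
    using that by (simp add: dsum_norm_single)
  ultimately show "isometrically_isomorphic (B n) (corner D (unit_at n))"
    unfolding isometrically_isomorphic_def by blast
qed

text \<open>
  In a finite-dimensional quotient almost all of the orthogonal idempotents \<open>unit_at n\<close> vanish. So the
  partial sums of \<open>\<Sum>n. c n \<cdot> unit_at n\<close> are eventually constant there, and they always have a coordinatewise
  limit. The limit may have a component along the unit.
\<close>

lemma diagonal_limit:
  assumes "limit_representation S p D h"
    and bound: "\<And>N. norm (\<Sum>n<N. norm (c n) *\<^sub>R u n) \<le> C"
  obtains b l where "b \<in> dsum_carrier u B" "dsum_norm u B b + norm l \<le> C"
    "\<And>n. b n = (c n - l) \<odot>\<^bsub>B n\<^esub> \<one>\<^bsub>B n\<^esub>"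
proof -
  interpret limit_representation S p D h by fact
  interpret D: unital_banach_algebra D by (rule dsum_banach_algebra)
  have h_zero: "h \<zero>\<^bsub>D\<^esub> r = \<zero>\<^bsub>S r\<^esub>" for r
    using h_simps(5)[of "\<zero>\<^bsub>D\<^esub>" 0 r] h_simps(1)[of "\<zero>\<^bsub>D\<^esub>" r]
    by (simp add: S.smult_zero_left B.smult_zero_left)
  define x :: "nat \<Rightarrow> (nat \<Rightarrow> 'b) \<times> 'k" where
    "x N = (\<lambda>n. if n < N then c n \<odot>\<^bsub>B n\<^esub> \<one>\<^bsub>B n\<^esub> else \<zero>\<^bsub>B n\<^esub>, 0)" for N
  have x_dsum: "fst (x N) \<in> dsum_carrier u B"
    and x_norm: "dsum_norm u B (fst (x N)) = norm (\<Sum>n<N. nrm (B n) (fst (x N) n) *\<^sub>R u n)" for N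
    using finite_support_dsum_carrier[of "fst (x N)" N] by (auto simp: x_def)
  have x: "x N \<in> carrier D" "nrm D (x N) \<le> C" for N
    using x_dsum[of N] x_norm[of N] bound[of N] by (simp_all add: x_def B.nrm_smult)
  have x_Suc: "x (Suc N) = x N \<oplus>\<^bsub>D\<^esub> c N \<odot>\<^bsub>D\<^esub> unit_at N" for N
    by (auto simp: x_def unit_at_def single_def fun_eq_iff less_Suc_eq)
  \<comment> \<open>For n < N the product no longer depends on N, so the n-th coefficient can be
    read off after passing to the limit.\<close>
  have unit_at_x: "unit_at n \<otimes>\<^bsub>D\<^esub> x N = c n \<odot>\<^bsub>D\<^esub> unit_at n" if "n < N" for n N
    using that unit_at_mult(1)[OF x_dsum[of N], of n 0]
    by (simp add: x_def B.smult_zero_left) (auto simp: unit_at_def single_def fun_eq_iff)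
  have "\<exists>K. \<forall>n\<ge>K. h (unit_at n) r = \<zero>\<^bsub>S r\<^esub>" for r
  proof -
    \<comment> \<open>The r-th coordinate is multiplicative, so it maps the units of the summands to
      orthogonal idempotents.\<close>
    have "finite {n. h (unit_at n) r \<noteq> \<zero>\<^bsub>S r\<^esub>}"
      by (rule S.finite_nonzero_orthogonal_idempotents[OF finite_dim])
        (simp_all add: h_simps(1) h_simps(3)[symmetric] unit_at_carrier unit_at_idem unit_at_orthogonal h_zero
          del: dsum_unitization_simps)
    then obtain K where "{n. h (unit_at n) r \<noteq> \<zero>\<^bsub>S r\<^esub>} \<subseteq> {..<K}" using finite_nat_bounded by blast
    then show ?thesis by (intro exI[of _ K]) (auto simp: subset_eq not_less[symmetric])
  qed
  then obtain K where K: "\<And>n r. K r \<le> n \<Longrightarrow> h (unit_at n) r = \<zero>\<^bsub>S r\<^esub>" by metis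
  define y where "y r = h (x (K r)) r" for r
  have y_eq: "h (x N) r = y r" if "K r \<le> N" for N r
    using that
  proof (induction N rule: dec_induct)
    case base
    then show ?case by (simp add: y_def)
  next
    case (step N)
    have "h (x (Suc N)) r = h (x N) r \<oplus>\<^bsub>S r\<^esub> c N \<odot>\<^bsub>S r\<^esub> h (unit_at N) r"
      unfolding x_Suc using x(1) unit_at_carrier D.smult_carrier by (simp add: h_simps(4,5) del: dsum_unitization_simps)
    then show ?case using step K[of r N] x(1)[of N] h_simps(1)[of "x N" r] by simp
  qed
  have "coherent y"
    unfolding coherent_def
  proof (intro conjI allI impI)
    show "y r \<in> carrier (S r)" for r unfolding y_def by (rule h_simps(1)[OF x(1)])
    fix r s :: nat assume "r \<le> s"
    then show "p r s (y s) = y r"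
      using y_eq[of s "max (K r) (K s)"] y_eq[of r "max (K r) (K s)"]
        h_simps(2)[OF x(1), of r s "max (K r) (K s)"] by simp
  qed
  moreover have "nrm (S r) (y r) \<le> C" for r
    unfolding y_def by (rule order_trans[OF h_le[OF x(1)] x(2)])
  ultimately obtain z where z: "z \<in> carrier D" "h z = y" "nrm D z \<le> C" by (rule h_surj)
  obtain b l where z_eq: "z = (b, l)" by (cases z)
  have b: "b \<in> dsum_carrier u B" using z(1) by (simp add: z_eq)
  have "b n = (c n - l) \<odot>\<^bsub>B n\<^esub> \<one>\<^bsub>B n\<^esub>" for n
  proof -
    \<comment> \<open>In each coordinate z agrees with a late partial sum, so both have the same
      product with \<open>unit_at n\<close>.\<close>
    have "unit_at n \<otimes>\<^bsub>D\<^esub> z = c n \<odot>\<^bsub>D\<^esub> unit_at n"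
    proof (rule h_inj)
      fix r
      let ?N = "max (K r) (Suc n)"
      have "h (unit_at n \<otimes>\<^bsub>D\<^esub> z) r = h (unit_at n) r \<otimes>\<^bsub>S r\<^esub> h (x ?N) r"
        using h_simps(3)[OF unit_at_carrier z(1)] y_eq[of r ?N] by (simp add: z(2))
      also have "\<dots> = h (unit_at n \<otimes>\<^bsub>D\<^esub> x ?N) r"
        by (rule h_simps(3)[OF unit_at_carrier x(1), symmetric])
      also have "\<dots> = h (c n \<odot>\<^bsub>D\<^esub> unit_at n) r" by (simp add: unit_at_x less_max_iff_disj)
      finally show "h (unit_at n \<otimes>\<^bsub>D\<^esub> z) r = h (c n \<odot>\<^bsub>D\<^esub> unit_at n) r" .
    qed (use unit_at_carrier z(1) D.m_closed D.smult_carrier in blast)+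
    then have "single n (b n \<oplus>\<^bsub>B n\<^esub> l \<odot>\<^bsub>B n\<^esub> \<one>\<^bsub>B n\<^esub>) n = (c n \<odot>\<^bsub>B n\<^esub> single n \<one>\<^bsub>B n\<^esub> n)"
      unfolding z_eq unit_at_mult(1)[OF b] by (simp add: unit_at_def fun_eq_iff)
    then have bl: "b n \<oplus>\<^bsub>B n\<^esub> l \<odot>\<^bsub>B n\<^esub> \<one>\<^bsub>B n\<^esub> = c n \<odot>\<^bsub>B n\<^esub> \<one>\<^bsub>B n\<^esub>"
      by (simp add: single_def)
    have "b n = b n \<oplus>\<^bsub>B n\<^esub> (l + - l) \<odot>\<^bsub>B n\<^esub> \<one>\<^bsub>B n\<^esub>"
      using dsum_carrierD(1)[OF b] by (simp add: B.smult_zero_left)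
    also have "\<dots> = b n \<oplus>\<^bsub>B n\<^esub> l \<odot>\<^bsub>B n\<^esub> \<one>\<^bsub>B n\<^esub> \<oplus>\<^bsub>B n\<^esub> (- l) \<odot>\<^bsub>B n\<^esub> \<one>\<^bsub>B n\<^esub>"
      using dsum_carrierD(1)[OF b, of n] by (simp only: B.smult_laws B.one_closed) (simp add: B.a_assoc)
    also have "\<dots> = (c n + - l) \<odot>\<^bsub>B n\<^esub> \<one>\<^bsub>B n\<^esub>"
      by (simp only: bl B.smult_laws(1)[OF B.one_closed])
    finally show ?thesis by simp
  qed
  then show thesis using that[OF b] z(3) by (simp add: z_eq)
qed

section \<open>Bounded completeness from diagonal limits\<close>

lemma boundedly_complete_if_limit:
  assumes "is_bounded_inverse_limit D"
  shows "boundedly_complete smul u"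
  unfolding boundedly_complete_def
proof (intro allI impI)
  fix a :: "nat \<Rightarrow> 'k" assume bdd: "bdd_above (range (\<lambda>N. norm (\<Sum>n\<le>N. smul (a n) (u n))))"
  obtain S :: "nat \<Rightarrow> ('k, nat \<Rightarrow> 'k) normed_algebra" and p h where
    rep: "limit_representation S p D h"
    using is_bounded_inverse_limitE[OF assms] .
  define f where "f M = norm (\<Sum>n<M. norm (a n) *\<^sub>R u n)" for M
  obtain C' where C': "\<And>N. norm (\<Sum>n\<le>N. smul (a n) (u n)) \<le> C'"
    using bdd by (auto simp: bdd_above_def)
  have "f M \<le> C'" for M
    unfolding f_def
    by (rule order_trans[OF norm_sum_subset_mono C'[of M, unfolded norm_sum_smul[OF finite_atMost]]])
      auto
  then have f_bdd: "bdd_above (range f)" by (auto simp: bdd_above_def)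
  \<comment> \<open>The least bound is essential: the improved bound C - L obtained below forces L =
    0 only against the supremum.\<close>
  define C where "C = (SUP M. f M)"
  have f_le: "f M \<le> C" for M unfolding C_def by (rule cSUP_upper[OF _ f_bdd]) simp
  txt \<open>Flipping signs does not change the norms of partial sums, but it moves the coefficients away
    from the limit of \<open>norm (a n)\<close>.\<close>
  define c :: "nat \<Rightarrow> nat \<Rightarrow> 'k" where
    "c M n = (if n < M then - of_real (norm (a n)) else of_real (norm (a n)))" for M n
  have "\<exists>b l. b \<in> dsum_carrier u B \<and> dsum_norm u B b + norm l \<le> C \<and>
      (\<forall>n. nrm (B n) (b n) = norm (c M n - l))" for M
  proof -
    have "norm (c M n) = norm (a n)" for n by (simp add: c_def)
    then have "norm (\<Sum>n<N. norm (c M n) *\<^sub>R u n) \<le> C" for N using f_le[of N] by (simp add: f_def)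
    then obtain b l where "b \<in> dsum_carrier u B" "dsum_norm u B b + norm l \<le> C"
      "\<And>n. b n = (c M n - l) \<odot>\<^bsub>B n\<^esub> \<one>\<^bsub>B n\<^esub>"
      using diagonal_limit[OF rep] by blast
    then show ?thesis by (intro exI[of _ b] exI[of _ l]) (simp add: B.nrm_smult)
  qed
  then obtain b l where b: "\<And>M. b M \<in> dsum_carrier u B"
      and bl: "\<And>M. dsum_norm u B (b M) + norm (l M) \<le> C"
      and nrm_b: "\<And>M n. nrm (B n) (b M n) = norm (c M n - l M)"
    by metis
  \<comment> \<open>Summability in the direct sum makes the coefficients |c_n - l| tend to 0. The
    flips affect finitely many terms, so the scalar part is the same for every M, and it is real and
    nonnegative.\<close>
  have lim: "(\<lambda>n. of_real (norm (a n))) \<longlonglongrightarrow> l M" for M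
  proof -
    have "(\<lambda>n. norm (c M n - l M)) \<longlonglongrightarrow> 0"
      using tendsto_zero_if_summable[OF dsum_carrierD(2)[OF b[of M]]] by (simp add: nrm_b)
    then have "c M \<longlonglongrightarrow> l M" by (simp add: tendsto_norm_zero_iff LIM_zero_iff)
    moreover have "\<forall>\<^sub>F n in sequentially. c M n = of_real (norm (a n))"
      using eventually_ge_at_top[of M] by eventually_elim (simp add: c_def)
    ultimately show ?thesis using tendsto_cong by fastforce
  qed
  define L where "L = norm (l 0)"
  have L: "0 \<le> L" by (simp add: L_def)
  have "(\<lambda>n. of_real (norm (a n)) :: 'k) \<longlonglongrightarrow> of_real L"
    using tendsto_of_real[OF tendsto_norm[OF lim[of 0]], where 'a = 'k] by (simp add: L_def)
  then have l: "l M = of_real L" for M using lim LIMSEQ_unique by blast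
  have "f M \<le> C - L" for M
  proof -
    \<comment> \<open>For n < M the flip makes the coefficient |a_n| + L, hence at least |a_n|;
      unflipped it would be the distance of |a_n| from L and could be smaller. The gain of L itself
      comes from the scalar part.\<close>
    have "f M \<le> norm (\<Sum>n<M. nrm (B n) (b M n) *\<^sub>R u n)"
      unfolding f_def
    proof (rule norm_sum_mono)
      fix n assume "n \<in> {..<M}"
      then have "c M n - l M = - of_real (norm (a n) + L)" by (simp add: c_def l)
      then have "nrm (B n) (b M n) = norm (a n) + L"
        unfolding nrm_b using L by (simp only: norm_minus_cancel norm_of_real) simp
      then show "\<bar>norm (a n)\<bar> \<le> \<bar>nrm (B n) (b M n)\<bar>" using L by simp
    qed simp
    also have "\<dots> \<le> dsum_norm u B (b M)"
      unfolding dsum_norm_def by (rule norm_sum_le_suminf[OF dsum_carrierD(2)[OF b]]) simp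
    also have "\<dots> \<le> C - L" using bl[of M] L by (simp add: l)
    finally show ?thesis .
  qed
  then have "(SUP M. f M) \<le> C - L" by (intro cSUP_least) simp_all
  then have "C \<le> C - L" by (simp add: C_def)
  then have "L = 0" using L by simp
  \<comment> \<open>Now M = 0 is used: nothing is flipped and l = 0, so the coefficients of
    \<open>b 0\<close> are exactly |a_n|.\<close>
  then have "summable (\<lambda>n. norm (a n) *\<^sub>R u n)"
    using dsum_carrierD(2)[OF b[of 0]] by (simp add: nrm_b l c_def)
  then show "summable (\<lambda>n. smul (a n) (u n))" by (rule summable_smul)
qed

end

theorem proposition10p11:
  fixes smul :: "'k::real_or_complex \<Rightarrow> 'u::banach \<Rightarrow> 'u"
    and u :: "nat \<Rightarrow> 'u"
    and B :: "nat \<Rightarrow> ('k, 'b) normed_algebra"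
  assumes "banach_space_over smul"
    and "schauder_basis smul u"
    and "normalized_basis u"
    and "one_unconditional smul u"
    and "\<And>n. unital_banach_algebra (B n)"
    and "\<And>n. carrier (B n) \<noteq> {\<zero>\<^bsub>B n\<^esub>}"
    and "\<And>n. nrm (B n) \<one>\<^bsub>B n\<^esub> = 1"
  shows "is_bounded_inverse_limit (dsum_unitization u B) \<longleftrightarrow>
           boundedly_complete smul u \<and> (\<forall>n. is_bounded_inverse_limit (B n))"
proof -
  interpret unital_sum smul u B
    using assms
    by (intro unital_sum.intro unconditional_sum.intro normalized_unconditional.intro
        unital_sum_axioms.intro unconditional_sum_axioms.intro normalized_unconditional_axioms.intro)
  show ?thesis
  proof
    assume "is_bounded_inverse_limit D"
    then show "boundedly_complete smul u \<and> (\<forall>n. is_bounded_inverse_limit (B n))"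
      using boundedly_complete_if_limit summand_is_bounded_inverse_limit by blast
  next
    assume R: "boundedly_complete smul u \<and> (\<forall>n. is_bounded_inverse_limit (B n))"
    \<comment> \<open>The common element type of all these systems allows one family S to be chosen
      for all n at once.\<close>
    have "\<exists>(S :: nat \<Rightarrow> ('k, nat \<Rightarrow> 'k) normed_algebra) p h. limit_representation S p (B n) h" for n
      by (rule is_bounded_inverse_limitE[of "B n"]) (use R in auto)
    then obtain S :: "nat \<Rightarrow> nat \<Rightarrow> ('k, nat \<Rightarrow> 'k) normed_algebra" and p h where
      rep: "\<And>n. limit_representation (S n) (p n) (B n) (h n)"
      by metis
    interpret sum_of_limits smul u B S p h
      by (intro sum_of_limits.intro sum_of_limits_axioms.intro unconditional_sum_axioms rep)
    show "is_bounded_inverse_limit D"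
      using R is_bounded_inverse_limit_dsum by blast
  qed
qed

end
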